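(* Consider the block problem with $K_1=1$ in the convex-nonconcave setting: for every $y\in\mathcal Y$ the function $f(\cdot,y)$ is convex on $\mathcal X$ (no concavity of $f$ in $y$ is assumed), and $f$ satisfies the Lipschitz gradient assumption with constants $L_{11},L_{12},L_{21},L_{22}>0$. Let $\bar\varrho,\bar\iota>0$ be constants with $\bar\varrho\le\frac1{10L_{11}}$, let $\hat b_k=\frac{19}{20\bar\varrho k^{1/4}}$ for $k\ge1$, let $$\tau>\max\Big\{\frac{\bar\varrho\hat b_2^2(L_{22}+2\bar\iota-\bar\varrho L_{21}^2)}{16L_{21}^2},\,2\Big\},\qquad \bar\vartheta_k=\bar\varrho L_{21}^2+\frac{16\tau L_{21}^2}{\bar\varrho\hat b_{k+1}^2}-2\bar\iota,\qquad p_k=\frac{8(\tau-2)L_{21}^2}{\bar\varrho\hat b_{k+1}^2},$$ and let $\{(x_k,y_k)\}_{k\ge1}$ be generated by the BAPG algorithm with $\beta_k^{(1)}=\frac1{\bar\varrho}$, $\xi_k^{(j)}=\bar\iota+\bar\vartheta_k$, $\hat c_k=0$ and $\hat b_k=\frac{19}{20\bar\varrho k^{1/4}}$, for all $k\ge1$ and all $j$. Then for any given $\varepsilon>0$, $$\mathcal T(\varepsilon)\le\max\left(\Big(\frac{2\cdot80^2\bar\varrho(\tau-2)L_{21}^2\hat r_2\hat r_3}{19^2\varepsilon^2}+2\Big)^2,\ \frac{19^4\hat\delta_x^4}{10^4\bar\varrho^4\varepsilon^4}\right),$$ where $\hat\delta_x=\max\{\|x\|:x\in\mathcal X\}$, $\hat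 r_2=\hat{\mathcal L}_0-\hat{\mathcal L}_2+\frac{8\cdot2^{1/4}}{\bar\varrho}\hat\delta_x^2+\frac{19}{40\bar\varrho}\hat\delta_x^2$, $\hat r_3=\max\big\{\hat d_1,\frac{10+20K_2\bar\varrho^2L_{12}^2}{9\bar\varrho p_2}\big\}$, $\hat d_1=\frac{16K_2\tau^2}{(\tau-2)^2}+\frac{19^4K_2(\bar\varrho L_{21}^2-\bar\iota+L_{22})^2}{16\cdot20^4\bar\varrho^2(\tau-2)^2L_{21}^4}$, $\hat{\mathcal L}_0=\hat l+\big(2^{13/4}+15+\frac{19}{40}\big)\frac{\hat\delta_x^2}{\bar\varrho}$ with $\hat l=\max_{(x,y)\in\mathcal X\times\mathcal Y}l(x,y)$, and $$\hat{\mathcal L}_2=l(x_2,y_2)-\frac{16\hat\delta_x^2}{\bar\varrho^2\hat b_2}-\frac{8\hat\delta_x^2}{\bar\varrho}-\Big(\frac{\bar\varrho L_{21}^2}{2}+\frac{16L_{21}^2}{\bar\varrho\hat b_2^2}\Big)\|y_2-y_1\|^2 .$$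
   Context: Block problem: $\min_{x\in\mathcal X}\max_{y\in\mathcal Y}l(x,y)$ with $l(x,y)=f(x,y)+\sum_{i=1}^{K_1}h_i(x^{(i)})-\sum_{j=1}^{K_2}g_j(y^{(j)})$, where $x=[x^{(1)},\dots,x^{(K_1)}]\in\mathcal X=\mathcal X_1\times\dots\times\mathcal X_{K_1}$, $y=[y^{(1)},\dots,y^{(K_2)}]\in\mathcal Y=\mathcal Y_1\times\dots\times\mathcal Y_{K_2}$, the $\mathcal X_i\subset\mathbb R^{d_x}$, $\mathcal Y_j\subset\mathbb R^{d_y}$ are nonempty compact convex sets, $f:\mathbb R^{d_xK_1+d_yK_2}\to\mathbb R$ is continuously differentiable, and $h_i:\mathbb R^{d_x}\to\mathbb R$, $g_j:\mathbb R^{d_y}\to\mathbb R$ are convex continuous, possibly nonsmooth. $\|\cdot\|$ is the Euclidean norm. Proximal operators: $\operatorname{Prox}_{h_i,\mathcal X_i}^{\beta}(\upsilon)=\arg\min_{u\in\mathcal X_i}h_i(u)+\frac\beta2\|u-\upsilon\|^2$ and $\operatorname{Prox}_{g_j,\mathcal Y_j}^{\xi}(\omega)=\arg\max_{u\in\mathcal Y_j}-g_j(u)-\frac\xi2\|u-\omega\|^2$. BAPG algorithm (parameters $\beta_k^{(i)},\xi_k^{(j)}>0$, $\hat b_k,\hat c_k\ge0$): from $(x_1,y_1)\in\mathcal X\times\mathcal Y$, for $k\ge1$, for $i=1,\dots,K_1$ in order, with $v_{k+1}^{(i)}=[x_{k+1}^{(1)},\dots,x_{k+1}^{(i-1)},x_k^{(i)},\dots,x_k^{(K_1)}]$,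 $$x_{k+1}^{(i)}=\operatorname{Prox}_{h_i,\mathcal X_i}^{\beta_k^{(i)}}\Big(x_k^{(i)}-\tfrac1{\beta_k^{(i)}}\nabla_{x^{(i)}}f(v_{k+1}^{(i)},y_k)-\tfrac1{\beta_k^{(i)}}\hat b_kx_k^{(i)}\Big);$$ then for $j=1,\dots,K_2$ in order, with $w_{k+1}^{(j)}=[y_{k+1}^{(1)},\dots,y_{k+1}^{(j-1)},y_k^{(j)},\dots,y_k^{(K_2)}]$, $$y_{k+1}^{(j)}=\operatorname{Prox}_{g_j,\mathcal Y_j}^{\xi_k^{(j)}}\Big(y_k^{(j)}+\tfrac1{\xi_k^{(j)}}\nabla_{y^{(j)}}f(x_{k+1},w_{k+1}^{(j)})-\tfrac1{\xi_k^{(j)}}\hat c_ky_k^{(j)}\Big).$$ Stationarity gap: $\nabla\mathcal G(x_k,y_k)$ is the vector with blocks $\beta_k^{(i)}\big(x_k^{(i)}-\operatorname{Prox}_{h_i,\mathcal X_i}^{\beta_k^{(i)}}(x_k^{(i)}-\frac1{\beta_k^{(i)}}\nabla_{x^{(i)}}f(x_k,y_k))\big)$, $i=1,\dots,K_1$, and $\xi_k^{(j)}\big(y_k^{(j)}-\operatorname{Prox}_{g_j,\mathcal Y_j}^{\xi_k^{(j)}}(y_k^{(j)}+\frac1{\xi_k^{(j)}}\nabla_{y^{(j)}}f(x_k,y_k))\big)$, $j=1,\dots,K_2$. $\mathcal T(\varepsilon)=\min\{k\ge1:\|\nabla\mathcal G(x_k,y_k)\|\le\varepsilon\}$. Lipschitz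 gradient assumption: for all $x,\bar x\in\mathcal X$, $y,\bar y\in\mathcal Y$: $\|\nabla_xf(x,y)-\nabla_xf(\bar x,y)\|\le L_{11}\|x-\bar x\|$, $\|\nabla_xf(x,y)-\nabla_xf(x,\bar y)\|\le L_{21}\|y-\bar y\|$, $\|\nabla_yf(x,y)-\nabla_yf(x,\bar y)\|\le L_{22}\|y-\bar y\|$, $\|\nabla_yf(x,y)-\nabla_yf(\bar x,y)\|\le L_{12}\|x-\bar x\|$. *)

theory Defs
  imports "HOL-Analysis.Analysis"
begin

text \<open>
  A block vector $x = [x^{(1)},\dots,x^{(K)}]$ with blocks in $\mathbb{R}^d$ is an element of
  \<^typ>\<open>((real, 'd) vec, 'k) vec\<close> with \<open>K = CARD('k)\<close>; the order in which the blocks are updated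
  is the linear order on the index type.  The norms of \<^type>\<open>vec\<close> and of pairs are Euclidean.
\<close>

definition grad :: "('a::real_inner \<Rightarrow> real) \<Rightarrow> 'a \<Rightarrow> 'a"
  where "grad f z = (THE D. GDERIV f z :> D)"

definition continuously_differentiable :: "('a::real_inner \<Rightarrow> real) \<Rightarrow> bool"
  where "continuously_differentiable f \<longleftrightarrow>
    (\<forall>z. f differentiable (at z)) \<and> continuous_on UNIV (grad f)"

definition grad_x :: "('a::real_inner \<times> 'b::real_inner \<Rightarrow> real) \<Rightarrow> 'a \<Rightarrow> 'b \<Rightarrow> 'a"
  where "grad_x f x y = fst (grad f (x, y))"

definition grad_y :: "('a::real_inner \<times> 'b::real_inner \<Rightarrow> real) \<Rightarrow> 'a \<Rightarrow> 'b \<Rightarrow> 'b"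
  where "grad_y f x y = snd (grad f (x, y))"

definition block_prod :: "('k \<Rightarrow> 'a set) \<Rightarrow> ('a ^ 'k::finite) set"
  where "block_prod X = {x. \<forall>i. x $ i \<in> X i}"

definition objective ::
  "(('a ^ 'k::finite) \<times> ('b ^ 'm::finite) \<Rightarrow> real) \<Rightarrow> ('k \<Rightarrow> 'a \<Rightarrow> real) \<Rightarrow> ('m \<Rightarrow> 'b \<Rightarrow> real)
     \<Rightarrow> 'a ^ 'k \<Rightarrow> 'b ^ 'm \<Rightarrow> real"
  where "objective f h g x y = f (x, y) + (\<Sum>i\<in>UNIV. h i (x $ i)) - (\<Sum>j\<in>UNIV. g j (y $ j))"

definition lipschitz_gradient ::
  "('a::real_inner \<times> 'b::real_inner \<Rightarrow> real) \<Rightarrow> 'a set \<Rightarrow> 'b set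
     \<Rightarrow> real \<Rightarrow> real \<Rightarrow> real \<Rightarrow> real \<Rightarrow> bool"
  where "lipschitz_gradient f X Y L11 L12 L21 L22 \<longleftrightarrow>
    (\<forall>x\<in>X. \<forall>x'\<in>X. \<forall>y\<in>Y. \<forall>y'\<in>Y.
       norm (grad_x f x y - grad_x f x' y) \<le> L11 * norm (x - x') \<and>
       norm (grad_x f x y - grad_x f x y') \<le> L21 * norm (y - y') \<and>
       norm (grad_y f x y - grad_y f x y') \<le> L22 * norm (y - y') \<and>
       norm (grad_y f x y - grad_y f x' y) \<le> L12 * norm (x - x'))"

text \<open>For convex continuous functions on nonempty compact convex sets and a positive parameter,
  both optimizers below exist and are unique.\<close>

definition prox_min :: "('a::real_normed_vector \<Rightarrow> real) \<Rightarrow> 'a set \<Rightarrow> real \<Rightarrow> 'a \<Rightarrow> 'a"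
  where "prox_min h X \<beta> v = arg_min_on (\<lambda>u. h u + \<beta> / 2 * (norm (u - v))\<^sup>2) X"

definition prox_max :: "('a::real_normed_vector \<Rightarrow> real) \<Rightarrow> 'a set \<Rightarrow> real \<Rightarrow> 'a \<Rightarrow> 'a"
  where "prox_max g Y \<xi> w = arg_max_on (\<lambda>u. - g u - \<xi> / 2 * (norm (u - w))\<^sup>2) Y"

text \<open>\<open>partial_update new old i\<close> carries the new blocks strictly before \<open>i\<close> and the old ones
  from \<open>i\<close> on; it gives the points $v_{k+1}^{(i)}$ and $w_{k+1}^{(j)}$ of the algorithm.\<close>

definition partial_update :: "('a, 'k::{finite,linorder}) vec \<Rightarrow> ('a, 'k) vec \<Rightarrow> 'k \<Rightarrow> ('a, 'k) vec"
  where "partial_update new old i = (\<chi> i'. if i' < i then new $ i' else old $ i')"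

text \<open>Sequences are indexed from 1; their values at index 0 play no role.\<close>

definition bapg ::
  "(('a::real_inner, 'k::{finite,linorder}) vec \<times> ('b::real_inner, 'm::{finite,linorder}) vec \<Rightarrow> real)
     \<Rightarrow> ('k \<Rightarrow> 'a \<Rightarrow> real) \<Rightarrow> ('m \<Rightarrow> 'b \<Rightarrow> real) \<Rightarrow> ('k \<Rightarrow> 'a set) \<Rightarrow> ('m \<Rightarrow> 'b set)
     \<Rightarrow> (nat \<Rightarrow> 'k \<Rightarrow> real) \<Rightarrow> (nat \<Rightarrow> 'm \<Rightarrow> real) \<Rightarrow> (nat \<Rightarrow> real) \<Rightarrow> (nat \<Rightarrow> real)
     \<Rightarrow> (nat \<Rightarrow> ('a, 'k) vec) \<Rightarrow> (nat \<Rightarrow> ('b, 'm) vec) \<Rightarrow> bool"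
  where "bapg f h g X Y \<beta> \<xi> b c x y \<longleftrightarrow>
    x 1 \<in> block_prod X \<and> y 1 \<in> block_prod Y \<and>
    (\<forall>k\<ge>1.
      (\<forall>i. x (k + 1) $ i = prox_min (h i) (X i) (\<beta> k i)
         (x k $ i - (1 / \<beta> k i) *\<^sub>R (grad_x f (partial_update (x (k + 1)) (x k) i) (y k) $ i)
            - (1 / \<beta> k i * b k) *\<^sub>R (x k $ i))) \<and>
      (\<forall>j. y (k + 1) $ j = prox_max (g j) (Y j) (\<xi> k j)
         (y k $ j + (1 / \<xi> k j) *\<^sub>R (grad_y f (x (k + 1)) (partial_update (y (k + 1)) (y k) j) $ j)
            - (1 / \<xi> k j * c k) *\<^sub>R (y k $ j))))"

text \<open>The step sizes \<open>\<beta>\<close>, \<open>\<xi>\<close> are those of a single iteration.\<close>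

definition stationarity_gap ::
  "(('a::real_inner ^ 'k::finite) \<times> ('b::real_inner ^ 'm::finite) \<Rightarrow> real)
     \<Rightarrow> ('k \<Rightarrow> 'a \<Rightarrow> real) \<Rightarrow> ('m \<Rightarrow> 'b \<Rightarrow> real) \<Rightarrow> ('k \<Rightarrow> 'a set) \<Rightarrow> ('m \<Rightarrow> 'b set)
     \<Rightarrow> ('k \<Rightarrow> real) \<Rightarrow> ('m \<Rightarrow> real) \<Rightarrow> 'a ^ 'k \<Rightarrow> 'b ^ 'm \<Rightarrow> ('a ^ 'k) \<times> ('b ^ 'm)"
  where "stationarity_gap f h g X Y \<beta> \<xi> x y =
    ((\<chi> i. \<beta> i *\<^sub>R (x $ i - prox_min (h i) (X i) (\<beta> i)
         (x $ i - (1 / \<beta> i) *\<^sub>R (grad_x f x y $ i)))),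
     (\<chi> j. \<xi> j *\<^sub>R (y $ j - prox_max (g j) (Y j) (\<xi> j)
         (y $ j + (1 / \<xi> j) *\<^sub>R (grad_y f x y $ j)))))"

text \<open>The first \<open>k \<ge> 1\<close> at which the gap is at most \<open>\<epsilon>\<close>. If there is none, the value is
  meaningless, so a bound on it has to be stated together with the existence of such a \<open>k\<close>.\<close>

definition hitting_time :: "(nat \<Rightarrow> 'a::real_normed_vector) \<Rightarrow> real \<Rightarrow> nat"
  where "hitting_time G \<epsilon> = (LEAST k. 1 \<le> k \<and> norm (G k) \<le> \<epsilon>)"

end

theory Submission
  imports Defs
begin

text \<open>
  Since \<open>f\<close> is convex in \<open>x\<close>, comparing the optimality conditions of two consecutive proximal steps
  in \<open>x\<close> shows that the objective, corrected by multiples of the squared norms of \<open>x\<close> and of the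
  last steps in \<open>x\<close> and \<open>y\<close>, almost increases along the iteration, with a gain proportional to the
  squared lengths of the new steps.  The objective is bounded, so the weighted sum of these squares
  is bounded by \<open>r2\<close>.  The squared gap at step \<open>k\<close> is at most a multiple of them plus a multiple of
  \<open>(b k)\<^sup>2 * \<delta>\<^sup>2\<close>, the bias caused by the regularization.  If the gap exceeded \<open>\<epsilon>\<close> for all \<open>k\<close> up to
  the claimed bound \<open>R\<close>, then, the bias being small from \<open>R / 4\<close> on, the sum over \<open>R / 4 \<le> k \<le> R\<close> of
  \<open>1 / p k\<close>, which is of order \<open>sqrt R\<close>, would contradict the bound.
\<close>

section \<open>Proximal operators\<close>

text \<open>The obstacle is that a minimization step may lower the objective. Convexity in x bounds
  \<open>l (x (k + 1)) (y k) - l (x k) (y k)\<close> below by a linear term, whose \<open>h\<close>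
  part is estimated by the optimality condition of the preceding step. What remains is a loss in the
  squared steps, and \<open>f\<close>, being merely convex in x, does not pay for it. The
  regularization does: it contributes to the difference of two optimality conditions a quadratic
  gain of order \<open>b k\<close>, so this difference must enter with weight 8 / (\<rho> * b k).
  The weight grows with k, and so does the resulting penalty of order 1 / (b k)^2 on the y steps,
  which makes \<open>\<xi> k\<close> and \<open>p k\<close> grow like sqrt k. The decay k^(-1/4) of
  \<open>b k\<close> balances this against the bias: the sum of 1 / p k up to R is of order sqrt R,
  while (b k)^2 is of order 1 / sqrt k, so both lead to R of order \<epsilon>^(-4). Since the
  gradient is known to be Lipschitz on the feasible set only, the inequality usually drawn from
  cocoercivity has to be proved inside a convex set.\<close>

lemma prox_max_eq_prox_min: "prox_max g Y \<xi> w = prox_min g Y \<xi> w"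
proof -
  have "(- g u - \<xi> / 2 * (norm (u - w))\<^sup>2 < - g v - \<xi> / 2 * (norm (v - w))\<^sup>2) \<longleftrightarrow>
        (g v + \<xi> / 2 * (norm (v - w))\<^sup>2 < g u + \<xi> / 2 * (norm (u - w))\<^sup>2)" for u v
    by linarith
  then show ?thesis
    unfolding prox_max_def prox_min_def arg_max_on_def arg_max_def is_arg_max_def
      arg_min_on_def arg_min_def is_arg_min_def by simp
qed

locale proximal =
  fixes h :: "'a::real_inner \<Rightarrow> real" and X :: "'a set" and \<beta> :: real
  assumes nonempty: "X \<noteq> {}" and compact: "compact X" and convex: "convex X"
    and h_convex: "convex_on X h" and h_cont: "continuous_on X h" and \<beta>_pos: "\<beta> > 0"
begin

lemma is_arg_min_prox:
  "is_arg_min (\<lambda>u. h u + \<beta> / 2 * (norm (u - v))\<^sup>2) (\<lambda>u. u \<in> X) (prox_min h X \<beta> v)"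
proof -
  have "continuous_on X (\<lambda>u. h u + \<beta> / 2 * (norm (u - v))\<^sup>2)"
    by (intro continuous_intros h_cont)
  from continuous_attains_inf[OF compact nonempty this]
  obtain p where "is_arg_min (\<lambda>u. h u + \<beta> / 2 * (norm (u - v))\<^sup>2) (\<lambda>u. u \<in> X) p"
    unfolding is_arg_min_linorder by blast
  then show ?thesis
    unfolding prox_min_def arg_min_on_def arg_min_def by (rule someI)
qed

lemma prox_in: "prox_min h X \<beta> v \<in> X"
  using is_arg_min_prox[of v] by (simp add: is_arg_min_linorder)

text \<open>Minimality of \<open>p\<close> against the points (1 - t) p + t u of the segment,
  divided by t: the quadratic term keeps a factor t and vanishes as t tends to 0.\<close>

lemma prox_variational:
  fixes v :: 'a
  assumes u: "u \<in> X"
  defines "p \<equiv> prox_min h X \<beta> v"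
  shows "h u - h p + \<beta> * ((p - v) \<bullet> (u - p)) \<ge> 0"
proof -
  have p: "p \<in> X" unfolding p_def by (rule prox_in)
  have main: "0 \<le> h u - h p + \<beta> * ((p - v) \<bullet> (u - p)) + t * (\<beta> / 2 * (norm (u - p))\<^sup>2)"
    if t: "0 < t" "t < 1" for t
  proof -
    define q where "q = (1 - t) *\<^sub>R p + t *\<^sub>R u"
    have q: "q \<in> X" unfolding q_def using convex p u t by (simp add: convexD)
    define A I N where "A = (norm (p - v))\<^sup>2" and "I = (p - v) \<bullet> (u - p)" and "N = (norm (u - p))\<^sup>2"
    have qv: "q - v = (p - v) + t *\<^sub>R (u - p)"
      by (simp add: q_def algebra_simps)
    have "(norm (q - v))\<^sup>2 = A + 2 * t * I + t\<^sup>2 * N"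
      unfolding qv A_def I_def N_def power2_norm_eq_inner by (simp add: inner_add_left inner_add_right
          inner_commute[of "u - p" "p - v"] power2_eq_square distrib_left)
    moreover have "h p + \<beta> / 2 * A \<le> h q + \<beta> / 2 * (norm (q - v))\<^sup>2"
      using is_arg_min_prox[of v] q unfolding is_arg_min_linorder p_def A_def by blast
    moreover have "h q \<le> (1 - t) * h p + t * h u"
      unfolding q_def using h_convex p u t by (simp add: convex_on_def)
    ultimately have "0 \<le> t * (h u - h p + \<beta> * I + t * (\<beta> / 2 * N))"
      by (simp add: algebra_simps power2_eq_square)
    then show ?thesis using t by (simp add: zero_le_mult_iff I_def N_def)
  qed
  have "((\<lambda>t. h u - h p + \<beta> * ((p - v) \<bullet> (u - p)) + t * (\<beta> / 2 * (norm (u - p))\<^sup>2)) \<longlongrightarrow>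
      h u - h p + \<beta> * ((p - v) \<bullet> (u - p)) + 0 * (\<beta> / 2 * (norm (u - p))\<^sup>2)) (at_right 0)"
    by (intro tendsto_intros)
  moreover have "\<forall>\<^sub>F t in at_right 0. 0 \<le> h u - h p + \<beta> * ((p - v) \<bullet> (u - p)) + t * (\<beta> / 2 * (norm (u - p))\<^sup>2)"
    using main by (intro eventually_at_rightI[of 0 1]) auto
  ultimately show ?thesis
    using tendsto_lowerbound by fastforce
qed

text \<open>Each of the two prox points is tested in the variational inequality of the other. In the
  sum the values of \<open>h\<close> cancel, which leaves firm nonexpansiveness; Cauchy-Schwarz then
  gives the claim.\<close>

lemma prox_nonexpansive:
  "norm (prox_min h X \<beta> v - prox_min h X \<beta> w) \<le> norm (v - w)"
proof -
  define p q where "p = prox_min h X \<beta> v" and "q = prox_min h X \<beta> w"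
  have "0 \<le> \<beta> * ((p - v) \<bullet> (q - p) + (q - w) \<bullet> (p - q))"
    using prox_variational[OF prox_in, of w v] prox_variational[OF prox_in, of v w]
    unfolding p_def q_def by (simp add: algebra_simps)
  then have "0 \<le> (p - v) \<bullet> (q - p) + (q - w) \<bullet> (p - q)"
    using \<beta>_pos by (simp add: zero_le_mult_iff)
  then have "norm (p - q) * norm (p - q) \<le> (v - w) \<bullet> (p - q)"
    by (simp add: power2_norm_eq_inner flip: power2_eq_square) (simp add: algebra_simps inner_commute)
  also have "\<dots> \<le> norm (v - w) * norm (p - q)"
    by (rule norm_cauchy_schwarz)
  finally show ?thesis
    unfolding p_def[symmetric] q_def[symmetric]
    by (cases "p = q") (simp, rule mult_right_le_imp_le[of _ "norm (p - q)"], auto)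
qed

end

section \<open>Lipschitz gradients on convex sets\<close>

text \<open>Since \<open>grad\<close> is a definite description, uniqueness is needed besides
  existence. Existence is the Riesz representation of the derivative in the standard basis.\<close>

lemma GDERIV_grad:
  fixes f :: "'a::euclidean_space \<Rightarrow> real"
  assumes "f differentiable (at z)"
  shows "GDERIV f z :> grad f z"
proof -
  obtain f' where f': "(f has_derivative f') (at z)"
    using assms by (auto simp: differentiable_def)
  then interpret bounded_linear f' by (rule has_derivative_bounded_linear)
  define D where "D = (\<Sum>b\<in>Basis. f' b *\<^sub>R b)"
  have "f' = (\<lambda>u. u \<bullet> D)"
  proof
    fix u
    have "f' u = f' (\<Sum>b\<in>Basis. (u \<bullet> b) *\<^sub>R b)" by (simp add: euclidean_representation)
    also have "\<dots> = (\<Sum>b\<in>Basis. (u \<bullet> b) * f' b)" by (simp add: sum scaleR)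
    finally show "f' u = u \<bullet> D" by (simp add: D_def inner_sum_right mult.commute)
  qed
  then have D: "GDERIV f z :> D"
    using f' unfolding gderiv_def by simp
  moreover have "D' = D" if "GDERIV f z :> D'" for D'
  proof -
    have "(\<lambda>u. u \<bullet> D') = (\<lambda>u. u \<bullet> D)"
      using that D unfolding gderiv_def by (rule has_derivative_unique)
    then have "(D' - D) \<bullet> D' = (D' - D) \<bullet> D"
      by (simp add: fun_eq_iff)
    then have "(D' - D) \<bullet> (D' - D) = 0"
      by (simp add: inner_diff_right)
    then show ?thesis by simp
  qed
  ultimately show ?thesis
    unfolding grad_def by (rule theI[of _ D])
qed

lemma GDERIV_grad_x:
  fixes f :: "'a::euclidean_space \<times> 'b::euclidean_space \<Rightarrow> real"
  assumes "f differentiable (at (u, v))"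
  shows "GDERIV (\<lambda>u. f (u, v)) u :> grad_x f u v"
proof -
  have "(f has_derivative (\<lambda>h. h \<bullet> grad f (u, v))) (at (u, v))"
    using GDERIV_grad[OF assms] by (simp add: gderiv_def)
  moreover have "((\<lambda>u. (u, v)) has_derivative (\<lambda>h. (h, 0))) (at u)"
    by (auto intro!: derivative_eq_intros)
  ultimately have "((\<lambda>u. f (u, v)) has_derivative (\<lambda>h. (h, 0) \<bullet> grad f (u, v))) (at u)"
    using has_derivative_compose by blast
  then show ?thesis
    by (simp add: gderiv_def grad_x_def inner_prod_def)
qed

lemma GDERIV_grad_y:
  fixes f :: "'a::euclidean_space \<times> 'b::euclidean_space \<Rightarrow> real"
  assumes "f differentiable (at (u, v))"
  shows "GDERIV (\<lambda>v. f (u, v)) v :> grad_y f u v"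
proof -
  have "(f has_derivative (\<lambda>h. h \<bullet> grad f (u, v))) (at (u, v))"
    using GDERIV_grad[OF assms] by (simp add: gderiv_def)
  moreover have "((\<lambda>v. (u, v)) has_derivative (\<lambda>h. (0, h))) (at v)"
    by (auto intro!: derivative_eq_intros)
  ultimately have "((\<lambda>v. f (u, v)) has_derivative (\<lambda>h. (0, h) \<bullet> grad f (u, v))) (at v)"
    using has_derivative_compose by blast
  then show ?thesis
    by (simp add: gderiv_def grad_y_def inner_prod_def)
qed

lemma GDERIV_DERIV_line:
  fixes \<phi> :: "'a::real_inner \<Rightarrow> real"
  assumes "GDERIV \<phi> (a + t *\<^sub>R u) :> D"
  shows "((\<lambda>t. \<phi> (a + t *\<^sub>R u)) has_real_derivative (D \<bullet> u)) (at t)"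
proof -
  have "((\<lambda>t. a + t *\<^sub>R u) has_derivative (\<lambda>h. h *\<^sub>R u)) (at t)"
    by (auto intro!: derivative_eq_intros)
  moreover have "(\<phi> has_derivative (\<lambda>h. h \<bullet> D)) (at (a + t *\<^sub>R u))"
    using assms by (simp add: gderiv_def)
  ultimately have "((\<lambda>t. \<phi> (a + t *\<^sub>R u)) has_derivative (\<lambda>h. (h *\<^sub>R u) \<bullet> D)) (at t)"
    using has_derivative_compose by blast
  moreover have "(\<lambda>h. (h *\<^sub>R u) \<bullet> D) = (*) (D \<bullet> u)"
    by (simp add: fun_eq_iff inner_commute)
  ultimately show ?thesis
    by (simp add: has_field_derivative_def)
qed

text \<open>Abstracts from f(., v) and f(u, .), so that the descent bounds serve both variables. The
  derivative is taken in the full space, but is controlled only between points of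
  \<open>S\<close>.\<close>

locale lipschitz_gradient_on =
  fixes \<phi> :: "'a::real_inner \<Rightarrow> real" and D :: "'a \<Rightarrow> 'a" and S :: "'a set" and L :: real
  assumes deriv: "\<And>z. z \<in> S \<Longrightarrow> GDERIV \<phi> z :> D z"
    and convex: "convex S"
    and L_nonneg: "L \<ge> 0"
    and lipschitz: "\<And>z z'. z \<in> S \<Longrightarrow> z' \<in> S \<Longrightarrow> norm (D z - D z') \<le> L * norm (z - z')"
begin

lemma segment_in: "a + t *\<^sub>R (b - a) \<in> S" if "a \<in> S" "b \<in> S" "0 \<le> t" "t \<le> 1"
  using convexD[OF convex that(1,2), of "1 - t" t] that by (simp add: algebra_simps)

text \<open>The sign \<sigma> treats the upper and the lower bound at once. \<open>\<psi>\<close> is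
  the error of the linearization along the segment minus the claimed bound, up to a constant; by the
  Lipschitz condition its derivative is nonpositive.\<close>

lemma descent_aux:
  assumes a: "a \<in> S" and b: "b \<in> S" and \<sigma>: "\<bar>\<sigma>\<bar> = 1"
  shows "\<sigma> * (\<phi> b - \<phi> a - D a \<bullet> (b - a)) \<le> L / 2 * (norm (b - a))\<^sup>2"
proof -
  define u where "u = b - a"
  define \<psi> where "\<psi> t = \<sigma> * (\<phi> (a + t *\<^sub>R u) - t * (D a \<bullet> u)) - L / 2 * t\<^sup>2 * (norm u)\<^sup>2" for t
  have seg: "a + t *\<^sub>R u \<in> S" if "0 \<le> t" "t \<le> 1" for t
    unfolding u_def using a b that by (rule segment_in)
  have "\<psi> 1 \<le> \<psi> 0"
  proof (rule DERIV_nonpos_imp_nonincreasing[of 0 1 \<psi>])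
    fix t :: real assume t: "0 \<le> t" "t \<le> 1"
    have "((\<lambda>t. \<phi> (a + t *\<^sub>R u)) has_real_derivative (D (a + t *\<^sub>R u) \<bullet> u)) (at t)"
      by (intro GDERIV_DERIV_line deriv seg t)
    then have "(\<psi> has_real_derivative
        (\<sigma> * (D (a + t *\<^sub>R u) \<bullet> u - D a \<bullet> u) - L * t * (norm u)\<^sup>2)) (at t)"
      unfolding \<psi>_def by (auto intro!: derivative_eq_intros)
    moreover have "\<sigma> * (D (a + t *\<^sub>R u) \<bullet> u - D a \<bullet> u) \<le> L * t * (norm u)\<^sup>2"
    proof -
      have "\<sigma> * (D (a + t *\<^sub>R u) \<bullet> u - D a \<bullet> u) \<le> \<bar>(D (a + t *\<^sub>R u) - D a) \<bullet> u\<bar>"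
        using \<sigma> by (simp add: inner_diff_left abs_if split: if_splits)
      also have "\<dots> \<le> norm (D (a + t *\<^sub>R u) - D a) * norm u"
        by (rule Cauchy_Schwarz_ineq2)
      also have "\<dots> \<le> (L * norm (t *\<^sub>R u)) * norm u"
        using lipschitz[OF seg[OF t] a] by (intro mult_right_mono) auto
      finally show ?thesis using t by (simp add: power2_eq_square mult.assoc)
    qed
    ultimately show "\<exists>y. (\<psi> has_real_derivative y) (at t) \<and> y \<le> 0"
      by (metis diff_le_0_iff_le)
  qed simp
  then show ?thesis
    unfolding \<psi>_def u_def by (simp add: right_diff_distrib)
qed

lemma descent:
  assumes "a \<in> S" "b \<in> S"
  shows "\<phi> b \<le> \<phi> a + D a \<bullet> (b - a) + L / 2 * (norm (b - a))\<^sup>2"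
    and "\<phi> b \<ge> \<phi> a + D a \<bullet> (b - a) - L / 2 * (norm (b - a))\<^sup>2"
  using descent_aux[OF assms, of 1] descent_aux[OF assms, of "-1"] by auto

end

locale convex_lipschitz_gradient_on = lipschitz_gradient_on +
  assumes convex_fun: "convex_on S \<phi>"
begin

text \<open>The chord inequality from convexity meets the lower descent bound at a + t (b - a);
  after division by t the curvature term is O(t).\<close>

lemma first_order:
  assumes a: "a \<in> S" and b: "b \<in> S"
  shows "\<phi> b \<ge> \<phi> a + D a \<bullet> (b - a)"
proof -
  have main: "0 \<le> \<phi> b - \<phi> a - D a \<bullet> (b - a) + t * (L / 2 * (norm (b - a))\<^sup>2)"
    if t: "0 < t" "t < 1" for t
  proof -
    have "\<phi> a + t * (D a \<bullet> (b - a)) - L / 2 * (t\<^sup>2 * (norm (b - a))\<^sup>2) \<le> \<phi> (a + t *\<^sub>R (b - a))"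
      using descent(2)[OF a segment_in[OF a b, of t]] t by (simp add: power_mult_distrib)
    moreover have "\<phi> (a + t *\<^sub>R (b - a)) \<le> (1 - t) * \<phi> a + t * \<phi> b"
      using convex_onD[OF convex_fun, of t a b] t a b by (simp add: algebra_simps)
    ultimately have "0 \<le> t * (\<phi> b - \<phi> a - D a \<bullet> (b - a) + t * (L / 2 * (norm (b - a))\<^sup>2))"
      by (simp only: power2_eq_square distrib_left distrib_right left_diff_distrib right_diff_distrib)
        (simp add: mult_ac)
    then show ?thesis using t by (simp add: zero_le_mult_iff)
  qed
  have "((\<lambda>t. \<phi> b - \<phi> a - D a \<bullet> (b - a) + t * (L / 2 * (norm (b - a))\<^sup>2)) \<longlongrightarrow>
      \<phi> b - \<phi> a - D a \<bullet> (b - a) + 0 * (L / 2 * (norm (b - a))\<^sup>2)) (at_right 0)"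
    by (intro tendsto_intros)
  moreover have "\<forall>\<^sub>F t in at_right 0. 0 \<le> \<phi> b - \<phi> a - D a \<bullet> (b - a) + t * (L / 2 * (norm (b - a))\<^sup>2)"
    using main by (intro eventually_at_rightI[of 0 1]) auto
  ultimately show ?thesis
    using tendsto_lowerbound by fastforce
qed

text \<open>The tangent at \<open>a\<close> lies below \<phi> at b + w/2, where \<phi> is at most
  its quadratic upper bound from \<open>b\<close>; symmetrically with the tangent at
  \<open>b\<close> and the point a - w/2. In the sum the values of \<phi> cancel, and the two halves
  of \<open>w\<close> add up.\<close>

lemma three_point_local:
  assumes a: "a \<in> S" and b: "b \<in> S" and w: "b + (1/2) *\<^sub>R w \<in> S" "a - (1/2) *\<^sub>R w \<in> S"
  shows "(D b - D a) \<bullet> (b - a + w) \<ge> - (L / 4) * (norm w)\<^sup>2"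
proof -
  have "\<phi> a + D a \<bullet> (b + (1/2) *\<^sub>R w - a) \<le> \<phi> b + D b \<bullet> ((1/2) *\<^sub>R w) + L / 2 * (norm ((1/2) *\<^sub>R w))\<^sup>2"
    using first_order[OF a w(1)] descent(1)[OF b w(1)] by simp
  moreover have "\<phi> b + D b \<bullet> (a - (1/2) *\<^sub>R w - b) \<le> \<phi> a - D a \<bullet> ((1/2) *\<^sub>R w) + L / 2 * (norm ((1/2) *\<^sub>R w))\<^sup>2"
    using first_order[OF b w(2)] descent(1)[OF a w(2)] by simp
  ultimately show ?thesis
    by (simp add: inner_diff_left inner_diff_right inner_add_right power_mult_distrib power2_eq_square)
qed

text \<open>Cutting the segment into n pieces, each with offset w / n, reduces the room needed
  beside it to w / (2n). Nothing is lost in the constant: the n error terms sum to 1/n of the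
  original one, and the gradient differences telescope to 1/n of the left-hand side.\<close>

lemma three_point_subdivided:
  fixes n :: nat
  assumes a: "a \<in> S" and b: "b \<in> S" and n: "n > 0"
    and w: "\<And>t. 0 \<le> t \<Longrightarrow> t \<le> 1 \<Longrightarrow> a + t *\<^sub>R (b - a) + (1 / (2 * n)) *\<^sub>R w \<in> S"
           "\<And>t. 0 \<le> t \<Longrightarrow> t \<le> 1 \<Longrightarrow> a + t *\<^sub>R (b - a) - (1 / (2 * n)) *\<^sub>R w \<in> S"
  shows "(D b - D a) \<bullet> (b - a + w) \<ge> - (L / 4) * (norm w)\<^sup>2"
proof -
  define z where "z i = a + (real i / n) *\<^sub>R (b - a)" for i :: nat
  have step: "- (L / 4) * (norm ((1 / n) *\<^sub>R w))\<^sup>2 \<le> (D (z (Suc i)) - D (z i)) \<bullet> ((1 / n) *\<^sub>R (b - a + w))"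
    if i: "i < n" for i
  proof -
    have *: "0 \<le> real i / n" "real i / n \<le> 1" "0 \<le> real (Suc i) / n" "real (Suc i) / n \<le> 1"
      using i by (simp_all add: divide_le_eq)
    have "z (Suc i) - z i + (1 / n) *\<^sub>R w = (1 / n) *\<^sub>R (b - a + w)"
      unfolding z_def by (simp add: algebra_simps add_divide_distrib)
    moreover have "z i \<in> S" "z (Suc i) \<in> S"
      unfolding z_def using * by (intro segment_in a b; simp)+
    moreover have "z (Suc i) + (1/2) *\<^sub>R ((1 / n) *\<^sub>R w) \<in> S" "z i - (1/2) *\<^sub>R ((1 / n) *\<^sub>R w) \<in> S"
      using w(1)[OF *(3,4)] w(2)[OF *(1,2)] unfolding z_def by simp_all
    ultimately show ?thesis
      using three_point_local[of "z i" "z (Suc i)" "(1 / n) *\<^sub>R w"] by simp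
  qed
  have "(\<Sum>i<n. - (L / 4) * (norm ((1 / n) *\<^sub>R w))\<^sup>2) \<le>
      (\<Sum>i<n. (D (z (Suc i)) - D (z i)) \<bullet> ((1 / n) *\<^sub>R (b - a + w)))"
    by (intro sum_mono step) simp
  also have "\<dots> = (D (z n) - D (z 0)) \<bullet> ((1 / n) *\<^sub>R (b - a + w))"
    using sum_lessThan_telescope[of "\<lambda>i. D (z i)" n] by (metis inner_sum_left)
  also have "\<dots> = (1 / n) * ((D b - D a) \<bullet> (b - a + w))"
    using n by (simp add: z_def)
  finally have "n * (- (L / 4) * (norm ((1 / n) *\<^sub>R w))\<^sup>2) \<le> (1 / n) * ((D b - D a) \<bullet> (b - a + w))"
    by simp
  moreover have "n * (- (L / 4) * (norm ((1 / n) *\<^sub>R w))\<^sup>2) = (1 / n) * (- (L / 4) * (norm w)\<^sup>2)"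
    using n by (simp add: power_divide power2_eq_square)
  ultimately have "(1 / n) * (- (L / 4) * (norm w)\<^sup>2) \<le> (1 / n) * ((D b - D a) \<bullet> (b - a + w))"
    by linarith
  then show ?thesis
    by (rule mult_left_le_imp_le) (simp add: n)
qed

text \<open>For a convex function with an \<open>L\<close>-Lipschitz gradient on the whole space this is a
  consequence of cocoercivity.  On a convex set the argument needs points outside the segment from
  \<open>a\<close> to \<open>b\<close>, but only in the direction \<open>w\<close>, and the centroid of \<open>a\<close>, \<open>b\<close>, \<open>c\<close> has room in
  that direction: so it applies after shrinking towards the centroid and subdividing.\<close>

lemma three_point:
  assumes a: "a \<in> S" and b: "b \<in> S" and c: "c \<in> S"
  shows "(D b - D a) \<bullet> (c - b) \<ge> - (L / 4) * (norm (c - b - (b - a)))\<^sup>2"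
proof -
  define w where "w = c - b - (b - a)"
  define m where "m = (1/3) *\<^sub>R a + (1/3) *\<^sub>R b + (1/3) *\<^sub>R c"
  have comb: "\<alpha> *\<^sub>R a + \<beta> *\<^sub>R b + \<gamma> *\<^sub>R c \<in> S" if "\<alpha> \<ge> 0" "\<beta> \<ge> 0" "\<gamma> \<ge> 0" "\<alpha> + \<beta> + \<gamma> = 1" for \<alpha> \<beta> \<gamma>
  proof -
    have "{a, b, c} \<subseteq> S" using a b c by simp
    then have "convex hull {a, b, c} \<subseteq> S" using convex by (simp add: subset_hull)
    then show ?thesis using that unfolding convex_hull_3 by blast
  qed
  have m: "m \<in> S" unfolding m_def by (rule comb) auto
  \<comment> \<open>Here w = a - 2 b + c, so m + t w has weight 1/3 - 2 t at \<open>b\<close>: t =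
    1/6 is the largest step for which it is nonnegative.\<close>
  have "m + (1/6) *\<^sub>R w = (1/2) *\<^sub>R a + 0 *\<^sub>R b + (1/2) *\<^sub>R c"
    unfolding m_def w_def by (simp add: algebra_simps flip: scaleR_add_left)
  then have mw1: "m + (1/6) *\<^sub>R w \<in> S" by (simp only:) (rule comb; simp)
  have "m - (1/6) *\<^sub>R w = (1/3 - 1/6) *\<^sub>R a + (1/3 + 1/3) *\<^sub>R b + (1/3 - 1/6) *\<^sub>R c"
    unfolding m_def w_def scaleR_left_diff_distrib scaleR_add_left by (simp add: algebra_simps flip: scaleR_add_left)
  then have mw2: "m - (1/6) *\<^sub>R w \<in> S" by (simp only:) (rule comb; simp)
  define sh where "sh \<mu> z = z + \<mu> *\<^sub>R (m - z)" for \<mu> z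
  have ineq: "- (L / 4) * (norm ((1 - \<mu>) *\<^sub>R w))\<^sup>2 \<le> (D (sh \<mu> b) - D (sh \<mu> a)) \<bullet> ((1 - \<mu>) *\<^sub>R (c - b))"
    if \<mu>: "0 < \<mu>" "\<mu> < 1" for \<mu>
  proof -
    \<comment> \<open>Contracting towards \<open>m\<close> by the factor 1 - \<mu> leaves room
      (\<mu>/6) w on both sides of the segment. The subdivision needs (1 - \<mu>) w / (2n), which
      fits once n \<mu> > 3; \<open>\<kappa>\<close> is the ratio of the two lengths.\<close>
    obtain n :: nat where n: "real n > 3 / \<mu>" using reals_Archimedean2 by blast
    moreover have "3 / \<mu> > 0" using \<mu> by simp
    ultimately have n0: "n > 0" using of_nat_0_less_iff by (metis less_trans)
    define q where "q = (1 / (2 * n)) * (1 - \<mu>)"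
    define \<kappa> where "\<kappa> = q / (\<mu> / 6)"
    have "3 < n * \<mu>" using n \<mu> by (simp add: field_simps)
    then have "3 * (1 - \<mu>) \<le> n * \<mu>" using \<mu> by (auto intro: order.trans)
    then have \<kappa>: "0 \<le> \<kappa>" "\<kappa> \<le> 1"
      using \<mu> n0 by (auto simp: \<kappa>_def q_def field_simps)
    have q: "q = \<kappa> * (\<mu> / 6)" using \<mu> by (simp add: \<kappa>_def)
    have sh_seg: "sh \<mu> a + t *\<^sub>R (sh \<mu> b - sh \<mu> a) = sh \<mu> (a + t *\<^sub>R (b - a))" for t
      unfolding sh_def by (simp add: algebra_simps)
    have room: "sh \<mu> z + \<sigma> *\<^sub>R (q *\<^sub>R w) \<in> S" if z: "z \<in> S" and \<sigma>: "m + \<sigma> *\<^sub>R ((1/6) *\<^sub>R w) \<in> S" for z \<sigma>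
    proof -
      have "m + \<kappa> *\<^sub>R (m + \<sigma> *\<^sub>R ((1/6) *\<^sub>R w) - m) \<in> S"
        using m \<sigma> \<kappa> by (rule segment_in)
      then have "z + \<mu> *\<^sub>R (m + \<kappa> *\<^sub>R (\<sigma> *\<^sub>R ((1/6) *\<^sub>R w)) - z) \<in> S"
        using segment_in[OF z, of "m + \<kappa> *\<^sub>R (\<sigma> *\<^sub>R ((1/6) *\<^sub>R w))" \<mu>] \<mu> by simp
      moreover have "z + \<mu> *\<^sub>R (m + \<kappa> *\<^sub>R (\<sigma> *\<^sub>R ((1/6) *\<^sub>R w)) - z) = sh \<mu> z + \<sigma> *\<^sub>R (q *\<^sub>R w)"
        unfolding sh_def q by (simp add: algebra_simps)
      ultimately show ?thesis by simp
    qed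
    have "- (L / 4) * (norm ((1 - \<mu>) *\<^sub>R w))\<^sup>2 \<le>
        (D (sh \<mu> b) - D (sh \<mu> a)) \<bullet> (sh \<mu> b - sh \<mu> a + (1 - \<mu>) *\<^sub>R w)"
    proof (rule three_point_subdivided[OF _ _ n0])
      show "sh \<mu> a \<in> S" "sh \<mu> b \<in> S"
        unfolding sh_def using \<mu> by (intro segment_in a b m; simp)+
    next
      fix t :: real assume t: "0 \<le> t" "t \<le> 1"
      show "sh \<mu> a + t *\<^sub>R (sh \<mu> b - sh \<mu> a) + (1 / (2 * n)) *\<^sub>R (1 - \<mu>) *\<^sub>R w \<in> S"
        using room[OF segment_in[OF a b t], of 1] mw1 unfolding sh_seg q_def by simp
      show "sh \<mu> a + t *\<^sub>R (sh \<mu> b - sh \<mu> a) - (1 / (2 * n)) *\<^sub>R (1 - \<mu>) *\<^sub>R w \<in> S"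
      proof -
        have "sh \<mu> (a + t *\<^sub>R (b - a)) - q *\<^sub>R w \<in> S"
          using room[OF segment_in[OF a b t], of "-1"] mw2 by simp
        then show ?thesis unfolding sh_seg q_def by simp
      qed
    qed
    moreover have "sh \<mu> b - sh \<mu> a + (1 - \<mu>) *\<^sub>R w = (1 - \<mu>) *\<^sub>R (c - b)"
      unfolding sh_def w_def by (simp add: algebra_simps)
    ultimately show ?thesis by simp
  qed
  \<comment> \<open>The Lipschitz bound makes \<open>D\<close> continuous along the contraction, so
    that \<mu> can tend to 0 in \<open>ineq\<close>.\<close>
  have cont: "((\<lambda>\<mu>. D (sh \<mu> z)) \<longlongrightarrow> D z) (at_right 0)" if z: "z \<in> S" for z
  proof (rule Lim_null_comparison[THEN LIM_zero_cancel])
    show "\<forall>\<^sub>F \<mu> in at_right 0. norm (D (sh \<mu> z) - D z) \<le> L * norm (\<mu> *\<^sub>R (m - z))"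
    proof (rule eventually_at_rightI[of 0 1])
      fix \<mu> :: real assume "\<mu> \<in> {0<..<1}"
      then show "norm (D (sh \<mu> z) - D z) \<le> L * norm (\<mu> *\<^sub>R (m - z))"
        using lipschitz[OF segment_in[OF z m, of \<mu>] z] unfolding sh_def by simp
    qed simp
    have "((\<lambda>\<mu>. L * norm (\<mu> *\<^sub>R (m - z))) \<longlongrightarrow> L * norm (0 *\<^sub>R (m - z))) (at_right (0::real))"
      by (intro tendsto_intros)
    then show "((\<lambda>\<mu>. L * norm (\<mu> *\<^sub>R (m - z))) \<longlongrightarrow> 0) (at_right (0::real))"
      by simp
  qed
  have "((\<lambda>\<mu>. (D (sh \<mu> b) - D (sh \<mu> a)) \<bullet> ((1 - \<mu>) *\<^sub>R (c - b)) + L / 4 * (norm ((1 - \<mu>) *\<^sub>R w))\<^sup>2) \<longlongrightarrow>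
      (D b - D a) \<bullet> ((1 - 0) *\<^sub>R (c - b)) + L / 4 * (norm ((1 - 0) *\<^sub>R w))\<^sup>2) (at_right 0)"
    by (intro tendsto_intros cont a b)
  moreover have "\<forall>\<^sub>F \<mu> in at_right 0. 0 \<le> (D (sh \<mu> b) - D (sh \<mu> a)) \<bullet> ((1 - \<mu>) *\<^sub>R (c - b)) + L / 4 * (norm ((1 - \<mu>) *\<^sub>R w))\<^sup>2"
    using ineq by (intro eventually_at_rightI[of 0 1]) fastforce+
  ultimately have "0 \<le> (D b - D a) \<bullet> ((1 - 0) *\<^sub>R (c - b)) + L / 4 * (norm ((1 - 0) *\<^sub>R w))\<^sup>2"
    by (rule tendsto_lowerbound) simp
  then show ?thesis by (simp add: w_def)
qed

end

section \<open>Energy estimates\<close>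

lemma young_inner:
  fixes u v :: "'a::real_inner"
  assumes "c > 0"
  shows "u \<bullet> v \<ge> - (c / 2 * (norm u)\<^sup>2 + 1 / (2 * c) * (norm v)\<^sup>2)"
proof -
  have "0 \<le> (norm (c *\<^sub>R u + v))\<^sup>2 / (2 * c)"
    using assms by simp
  also have "\<dots> = c / 2 * (norm u)\<^sup>2 + u \<bullet> v + 1 / (2 * c) * (norm v)\<^sup>2"
    using assms unfolding power2_norm_eq_inner
    by (simp add: inner_add_left inner_add_right inner_commute[of v u] field_simps power2_eq_square)
  finally show ?thesis by simp
qed

text \<open>In the application \<open>d\<close> and \<open>s\<close> are two successive steps of the minimization variable starting
  at \<open>x0\<close>, \<open>E\<close> is the length of the step of the maximization variable in between, and \<open>D1 + D2\<close>
  is the change of the partial gradient, split accordingly.  The bound \<open>primal\<close> alone loses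
  multiples of \<open>(norm s)\<^sup>2\<close> and \<open>(norm d)\<^sup>2\<close>; adding \<open>8 / (\<rho> * b1)\<close> times \<open>optimality\<close> makes up for
  them.  The terms in \<open>(norm (s - d))\<^sup>2\<close> can be dropped in both since \<open>1/2 - 1/40 - 19/40 = 0\<close>.\<close>

lemma minimization_step:
  fixes D1 D2 d s x0 :: "'a::real_inner"
  assumes \<rho>: "\<rho> > 0" and b: "b1 > 0" "b1 \<le> b0" "b0 \<le> 19 / (20 * \<rho>)"
    and L: "L \<le> 1 / (10 * \<rho>)"
    and primal: "\<Delta> \<ge> (D1 + D2) \<bullet> s - d \<bullet> s / \<rho> - b0 * (x0 \<bullet> s)"
    and optimality: "((1 / \<rho>) *\<^sub>R (s - d) + (D1 + D2) + b1 *\<^sub>R (x0 + d) - b0 *\<^sub>R x0) \<bullet> s \<le> 0"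
    and D2: "D2 \<bullet> s \<ge> - (L / 4) * (norm (s - d))\<^sup>2"
    and D1: "norm D1 \<le> M * E"
  shows "\<Delta> \<ge> 4 / (\<rho>\<^sup>2 * b1) * ((norm s)\<^sup>2 - (norm d)\<^sup>2) - (\<rho> * M\<^sup>2 / 2 + 16 * M\<^sup>2 / (\<rho> * b1\<^sup>2)) * E\<^sup>2
      - (b0 / 2 + 4 / \<rho> * (b0 / b1 - 1)) * ((norm (x0 + d + s))\<^sup>2 - (norm (x0 + d))\<^sup>2)
      + 2 / \<rho> * (norm s)\<^sup>2 + 2 / \<rho> * (norm d)\<^sup>2"
proof -
  define S R P Q N1 N2 W T where "S = (norm s)\<^sup>2" and "R = (norm d)\<^sup>2" and "P = d \<bullet> s" and "Q = x0 \<bullet> s"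
    and "N1 = D1 \<bullet> s" and "N2 = D2 \<bullet> s" and "W = (norm (s - d))\<^sup>2"
    and "T = (norm (x0 + d + s))\<^sup>2 - (norm (x0 + d))\<^sup>2"
  define r where "r = b0 / b1"
  define k where "k = 8 / (\<rho> * b1)"
  have nonneg: "S \<ge> 0" "R \<ge> 0" "W \<ge> 0" by (simp_all add: S_def R_def W_def)
  have r: "r \<ge> 1" using b by (simp add: r_def)
  have k: "k > 0" "k * b1 = 8 / \<rho>" "k * b0 = 8 * r / \<rho>" using \<rho> b by (simp_all add: k_def r_def)
  \<comment> \<open>Polarization expresses both inner products \<open>P\<close> and \<open>Q\<close>
    by \<open>S\<close>, \<open>R\<close>, \<open>W\<close> and \<open>T\<close>; from here on only
    linear arithmetic in these quantities is left.\<close>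
  have P: "P = (S + R - W) / 2"
    unfolding P_def S_def R_def W_def power2_norm_eq_inner by (simp add: inner_diff inner_commute)
  have "T = 2 * Q + 2 * P + S"
    unfolding T_def Q_def P_def S_def power2_norm_eq_inner
    by (simp add: inner_add_left inner_add_right inner_commute)
  then have Q: "Q = (T - 2 * P - S) / 2" by simp
  have D1sq: "(norm D1)\<^sup>2 \<le> M\<^sup>2 * E\<^sup>2"
    using power_mono[OF D1, of 2] by (simp add: power_mult_distrib)
  have "N1 \<ge> - (\<rho> / 2 * (norm D1)\<^sup>2 + 1 / (2 * \<rho>) * S)"
    unfolding N1_def S_def using \<rho> by (rule young_inner)
  moreover have "\<rho> / 2 * (norm D1)\<^sup>2 \<le> \<rho> / 2 * (M\<^sup>2 * E\<^sup>2)"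
    using \<rho> D1sq by (intro mult_left_mono) auto
  ultimately have N1: "N1 \<ge> - (\<rho> * M\<^sup>2 / 2 * E\<^sup>2) - 1 / (2 * \<rho>) * S" by simp
  \<comment> \<open>A second Young inequality for the same term. The weight 4 / b1 is chosen so
    that, after multiplication by \<open>k\<close>, the loss in \<open>S\<close> is exactly 1 /
    \<rho>; this produces the coefficient 16 M^2 / (\<rho> b1^2) of E^2.\<close>
  have "N1 \<ge> - (4 / b1 / 2 * (norm D1)\<^sup>2 + 1 / (2 * (4 / b1)) * S)"
    unfolding N1_def S_def using b by (intro young_inner) simp
  moreover have "4 / b1 / 2 * (norm D1)\<^sup>2 \<le> 4 / b1 / 2 * (M\<^sup>2 * E\<^sup>2)"
    using b D1sq by (intro mult_left_mono) auto
  ultimately have "k * N1 \<ge> k * (- (2 / b1 * (M\<^sup>2 * E\<^sup>2)) - b1 / 8 * S)"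
    using k(1) by (intro mult_left_mono) auto
  also have "k * (- (2 / b1 * (M\<^sup>2 * E\<^sup>2)) - b1 / 8 * S) = - (16 * M\<^sup>2 / (\<rho> * b1\<^sup>2) * E\<^sup>2) - 1 / \<rho> * S"
    using \<rho> b by (simp add: k_def field_simps power2_eq_square)
  finally have kN1: "k * N1 \<ge> - (16 * M\<^sup>2 / (\<rho> * b1\<^sup>2) * E\<^sup>2) - 1 / \<rho> * S" .
  have "L / 4 * W \<le> 1 / (10 * \<rho>) / 4 * W" using L nonneg by (intro mult_right_mono) auto
  then have N2: "N2 \<ge> - (1 / (40 * \<rho>)) * W" using D2 by (simp add: N2_def W_def)
  have "b0 / 2 * W \<le> 19 / (20 * \<rho>) / 2 * W" using b nonneg by (intro mult_right_mono) auto
  moreover have "1 / (2 * \<rho>) * W - 1 / (40 * \<rho>) * W = 19 / (20 * \<rho>) / 2 * W" by (simp add: field_simps)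
  ultimately have W: "1 / (2 * \<rho>) * W - 1 / (40 * \<rho>) * W - b0 / 2 * W \<ge> 0" by simp
  have bQ: "b0 * Q = b0 / 2 * T - b0 * S - b0 / 2 * R + b0 / 2 * W"
    unfolding Q P by (simp add: field_simps)
  have "\<Delta> \<ge> N1 + N2 - P / \<rho> - b0 * Q"
    using primal by (simp add: N1_def N2_def P_def Q_def inner_add_left)
  moreover have "P / \<rho> = 1 / (2 * \<rho>) * S + 1 / (2 * \<rho>) * R - 1 / (2 * \<rho>) * W"
    unfolding P by (simp add: add_divide_distrib diff_divide_distrib mult.commute)
  moreover have "b0 * S \<ge> 0" "b0 / 2 * R \<ge> 0" using b nonneg by auto
  moreover have "1 / (2 * \<rho>) * S + 1 / (2 * \<rho>) * S = 1 / \<rho> * S" by (simp add: field_simps)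
  ultimately have one: "\<Delta> \<ge> - (\<rho> * M\<^sup>2 / 2 * E\<^sup>2) - 1 / \<rho> * S - 1 / (2 * \<rho>) * R - b0 / 2 * T"
    using N1 N2 W bQ by linarith
  have "(S - P) / \<rho> + N1 + N2 + b1 * (Q + P) - b0 * Q \<le> 0"
    using optimality
    by (simp add: S_def N1_def N2_def P_def Q_def inner_add_left inner_diff_left power2_norm_eq_inner distrib_left)
  moreover have "(S - P) / \<rho> = 1 / (2 * \<rho>) * (S - R) + 1 / (2 * \<rho>) * W"
    unfolding P by (simp add: add_divide_distrib diff_divide_distrib mult.commute)
  moreover have "b1 * (Q + P) = b1 * (T - S) / 2"
    unfolding Q by (simp add: field_simps)
  ultimately have "1 / (2 * \<rho>) * (S - R) + b1 * (T - S) / 2 - b0 / 2 * T + b0 * S + b0 / 2 * R + N1 \<le> 0"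
    using N2 W bQ by linarith
  then have "k * (1 / (2 * \<rho>) * (S - R) + b1 * (T - S) / 2 - b0 / 2 * T + b0 * S + b0 / 2 * R + N1) \<le> 0"
    using k(1) by (simp add: mult_le_0_iff)
  moreover have "k * (1 / (2 * \<rho>) * (S - R) + b1 * (T - S) / 2 - b0 / 2 * T + b0 * S + b0 / 2 * R + N1)
      = k * (1 / (2 * \<rho>)) * (S - R) + k * b1 * (T - S) / 2 - k * b0 / 2 * T + k * b0 * S + k * b0 / 2 * R + k * N1"
    by (simp add: algebra_simps)
  ultimately have "k * (1 / (2 * \<rho>)) * (S - R) + k * b1 * (T - S) / 2 - k * b0 / 2 * T + k * b0 * S
      + k * b0 / 2 * R + k * N1 \<le> 0"
    by linarith
  moreover have "k * (1 / (2 * \<rho>)) = 4 / (\<rho>\<^sup>2 * b1)"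
    by (simp add: k_def power2_eq_square)
  ultimately have two: "0 \<ge> 4 / (\<rho>\<^sup>2 * b1) * (S - R) + 8 / \<rho> * (T - S) / 2 - 8 * r / \<rho> / 2 * T
      + 8 * r / \<rho> * S + 8 * r / \<rho> / 2 * R + k * N1"
    unfolding k by (simp only:)
  \<comment> \<open>The gain due to the regularization. In units of 1 / \<rho> the balance for
    \<open>S\<close> is 8 - 4 - 1 - 1 = 2, with 4 lost to the b1 term and 1 to each Young
    inequality, where the latter of these includes the linear term of the step; for \<open>R\<close>
    it is 4 - 1/2, at least 2.\<close>
  have "8 / \<rho> * S \<le> 8 * r / \<rho> * S" "4 / \<rho> * R \<le> 8 * r / \<rho> / 2 * R"
    using r \<rho> nonneg by (intro mult_right_mono; simp add: divide_right_mono)+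
  then have "\<Delta> \<ge> 4 / (\<rho>\<^sup>2 * b1) * (S - R) + (8 / \<rho> * (T - S) / 2 - 8 * r / \<rho> / 2 * T)
      + 8 / \<rho> * S + 4 / \<rho> * R - (16 * M\<^sup>2 / (\<rho> * b1\<^sup>2) * E\<^sup>2) - 1 / \<rho> * S
      - (\<rho> * M\<^sup>2 / 2 * E\<^sup>2) - 1 / \<rho> * S - 1 / (2 * \<rho>) * R - b0 / 2 * T"
    using one two kN1 by linarith
  moreover have "8 / \<rho> * (T - S) / 2 - 8 * r / \<rho> / 2 * T = - (4 / \<rho> * (r - 1) * T) - 4 / \<rho> * S"
    using \<rho> by (simp add: field_simps)
  moreover have "8 / \<rho> * S - 4 / \<rho> * S - 1 / \<rho> * S - 1 / \<rho> * S = 2 / \<rho> * S" by (simp add: field_simps)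
  moreover have "4 / \<rho> * R - 1 / (2 * \<rho>) * R \<ge> 2 / \<rho> * R"
    using nonneg \<rho> by (simp add: field_simps)
  ultimately have "\<Delta> \<ge> 4 / (\<rho>\<^sup>2 * b1) * (S - R) - (16 * M\<^sup>2 / (\<rho> * b1\<^sup>2) * E\<^sup>2) - (\<rho> * M\<^sup>2 / 2 * E\<^sup>2)
      - b0 / 2 * T - 4 / \<rho> * (r - 1) * T + 2 / \<rho> * S + 2 / \<rho> * R"
    by linarith
  then show ?thesis
    by (simp add: S_def R_def T_def r_def distrib_right)
qed

text \<open>A Lyapunov argument with the corrected objective \<open>V\<close>. The corrections have
  coefficients depending on k, so telescoping costs their variation: slow growth of 1 / b controls
  it for \<open>s\<close>, and monotonicity of \<open>c\<close> with \<nu> \<le> \<delta>^2 makes it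
  telescope again for \<nu>.\<close>

lemma energy_sum:
  fixes l \<nu> s e b p A :: "nat \<Rightarrow> real" and \<rho> \<delta> l_max :: real and N :: nat
  defines "c \<equiv> \<lambda>k. b (k - 1) / 2 + 4 / \<rho> * (b (k - 1) / b k - 1)"
  assumes \<rho>: "\<rho> > 0"
    and b_pos: "\<And>k. k \<ge> 1 \<Longrightarrow> b k > 0"
    and b_inverse: "\<And>k. k \<ge> 2 \<Longrightarrow> 1 / b (k + 1) - 1 / b k \<le> \<rho> / 4"
    and c_decreasing: "\<And>k. k \<ge> 2 \<Longrightarrow> c (k + 1) \<le> c k"
    and c_nonneg: "\<And>k. k \<ge> 2 \<Longrightarrow> 0 \<le> c k"
    and A_nonneg: "\<And>k. k \<ge> 2 \<Longrightarrow> 0 \<le> A k"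
    and step: "\<And>k. k \<ge> 2 \<Longrightarrow> l (k + 1) - l k \<ge>
        4 / (\<rho>\<^sup>2 * b k) * (s (k + 1) - s k) - A k * e k - c k * (\<nu> (k + 1) - \<nu> k)
        + 2 / \<rho> * s (k + 1) + 2 / \<rho> * s k + (p k + A (k + 1)) * e (k + 1)"
    and l_le: "\<And>k. k \<ge> 2 \<Longrightarrow> l k \<le> l_max"
    and \<nu>: "\<And>k. k \<ge> 2 \<Longrightarrow> 0 \<le> \<nu> k" "\<And>k. k \<ge> 2 \<Longrightarrow> \<nu> k \<le> \<delta>\<^sup>2"
    and s: "\<And>k. k \<ge> 2 \<Longrightarrow> 0 \<le> s k" "\<And>k. k \<ge> 2 \<Longrightarrow> s k \<le> 4 * \<delta>\<^sup>2"
    and e: "\<And>k. k \<ge> 2 \<Longrightarrow> 0 \<le> e k"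
    and N: "N \<ge> 1"
  shows "(\<Sum>k=2..N. p k * e (k + 1) + 3 / \<rho> * s (k + 1)) \<le>
    l_max - l 2 + 16 * \<delta>\<^sup>2 / (\<rho>\<^sup>2 * b 2) + A 2 * e 2 + 8 * \<delta>\<^sup>2 / \<rho> + c 2 * \<delta>\<^sup>2"
proof -
  \<comment> \<open>The last summand shifts the gain 2 / \<rho> * s k to index k + 1. There it adds
    up to 4 / \<rho>, of which the growth of 1 / b consumes 1 / \<rho>; this is the origin of 3 /
    \<rho>.\<close>
  define V where "V k = l k - 4 / (\<rho>\<^sup>2 * b k) * s k - A k * e k + c k * \<nu> k + 2 / \<rho> * s k" for k
  have V_step: "p k * e (k + 1) + 3 / \<rho> * s (k + 1) \<le> V (k + 1) - V k + (c k - c (k + 1)) * \<delta>\<^sup>2"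
    if k: "k \<ge> 2" for k
  proof -
    have "(c k - c (k + 1)) * \<nu> (k + 1) \<le> (c k - c (k + 1)) * \<delta>\<^sup>2"
      using c_decreasing[OF k] \<nu>(2)[of "k + 1"] k by (intro mult_left_mono) auto
    moreover have "4 / \<rho>\<^sup>2 * (1 / b (k + 1) - 1 / b k) * s (k + 1) \<le> 4 / \<rho>\<^sup>2 * (\<rho> / 4) * s (k + 1)"
      using b_inverse[OF k] s(1)[of "k + 1"] k by (intro mult_right_mono mult_left_mono) auto
    then have "4 / (\<rho>\<^sup>2 * b (k + 1)) * s (k + 1) - 4 / (\<rho>\<^sup>2 * b k) * s (k + 1) \<le> 1 / \<rho> * s (k + 1)"
      using \<rho> by (simp add: power2_eq_square left_diff_distrib right_diff_distrib)
    moreover have "1 / \<rho> * s (k + 1) + 3 / \<rho> * s (k + 1) = 2 / \<rho> * s (k + 1) + 2 / \<rho> * s (k + 1)"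
      by (simp add: field_simps)
    ultimately show ?thesis
      using step[OF k] unfolding V_def by (simp add: left_diff_distrib right_diff_distrib distrib_right)
  qed
  have "(\<Sum>k=2..N. p k * e (k + 1) + 3 / \<rho> * s (k + 1)) \<le> V (N + 1) - V 2 + (c 2 - c (N + 1)) * \<delta>\<^sup>2"
    using N
  proof (induction N rule: dec_induct)
    case base
    then show ?case by (simp add: numeral_2_eq_2)
  next
    case (step n)
    then show ?case
      using V_step[of "Suc n"] by (simp add: algebra_simps)
  qed
  moreover have "V (N + 1) \<le> l_max + c (N + 1) * \<delta>\<^sup>2 + 8 * \<delta>\<^sup>2 / \<rho>"
  proof -
    have "N + 1 \<ge> 2" using N by simp
    moreover have "4 / (\<rho>\<^sup>2 * b (N + 1)) * s (N + 1) \<ge> 0"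
      using b_pos[of "N + 1"] s(1)[of "N + 1"] N by simp
    moreover have "c (N + 1) * \<nu> (N + 1) \<le> c (N + 1) * \<delta>\<^sup>2"
      using \<nu>(2)[of "N + 1"] c_nonneg[of "N + 1"] N by (intro mult_left_mono) auto
    moreover have "2 / \<rho> * s (N + 1) \<le> 2 / \<rho> * (4 * \<delta>\<^sup>2)"
      using s(2)[of "N + 1"] \<rho> N by (intro mult_left_mono) auto
    moreover have "A (N + 1) * e (N + 1) \<ge> 0"
      using A_nonneg[of "N + 1"] e[of "N + 1"] N by simp
    ultimately show ?thesis
      using l_le[of "N + 1"] unfolding V_def by simp
  qed
  moreover have "V 2 \<ge> l 2 - 16 * \<delta>\<^sup>2 / (\<rho>\<^sup>2 * b 2) - A 2 * e 2"
  proof -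
    have "4 / (\<rho>\<^sup>2 * b 2) * s 2 \<le> 4 / (\<rho>\<^sup>2 * b 2) * (4 * \<delta>\<^sup>2)"
      using b_pos[of 2] s(2)[of 2] by (intro mult_left_mono) auto
    moreover have "c 2 * \<nu> 2 \<ge> 0" "2 / \<rho> * s 2 \<ge> 0"
      using c_nonneg[of 2] \<nu>(1)[of 2] s(1)[of 2] \<rho> by auto
    ultimately show ?thesis unfolding V_def by simp
  qed
  ultimately show ?thesis
    by (simp add: left_diff_distrib)
qed

text \<open>Comparison with the integral of the inverse square root, in telescoping form: each
  summand dominates an increment of 2 sqrt.\<close>

lemma sum_inverse_sqrt_ge:
  assumes "m \<le> N"
  shows "(\<Sum>k=m..N. 1 / sqrt (real k + 1)) \<ge> 2 * (sqrt (real N + 2) - sqrt (real m + 1))"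
proof -
  have increment: "2 * (sqrt (real k + 2) - sqrt (real k + 1)) \<le> 1 / sqrt (real k + 1)" for k
  proof -
    have "(sqrt (real k + 2) - sqrt (real k + 1)) * (sqrt (real k + 2) + sqrt (real k + 1)) = 1"
      by (simp add: algebra_simps)
    then have "sqrt (real k + 2) - sqrt (real k + 1) = 1 / (sqrt (real k + 2) + sqrt (real k + 1))"
      by (metis eq_divide_eq mult_zero_right zero_neq_one)
    also have "\<dots> \<le> 1 / (2 * sqrt (real k + 1))"
      by (intro divide_left_mono) (auto intro!: mult_pos_pos add_pos_pos)
    finally show ?thesis by simp
  qed
  show ?thesis using assms
  proof (induction N rule: dec_induct)
    case base
    then show ?case using increment[of m] by simp
  next
    case (step n)
    have "2 * (sqrt (real (Suc n) + 1) - sqrt (real m + 1)) \<le> (\<Sum>k=m..n. 1 / sqrt (real k + 1))"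
      using step.IH by (simp add: add.commute)
    moreover have "(\<Sum>k=m..Suc n. 1 / sqrt (real k + 1)) =
        (\<Sum>k=m..n. 1 / sqrt (real k + 1)) + 1 / sqrt (real (Suc n) + 1)"
      using step.hyps by simp
    moreover have "2 * (z - x) \<le> t" if "2 * (y - x) \<le> a" "t = a + b" "2 * (z - y) \<le> b" for x y z a b t :: real
      using that unfolding right_diff_distrib by linarith
    ultimately show ?case using increment[of "Suc n"] by blast
  qed
qed

text \<open>The sum up to R is about 2 sqrt R, and dropping the part below R / 4 removes about half
  of it. Rounding costs the constant 2, which becomes the summand 2 inside the square of the final
  bound. The lower limit 2 is where the energy estimate starts.\<close>

lemma sum_inverse_sqrt_quarter_ge:
  assumes R: "R \<ge> 4"
  defines "N \<equiv> nat \<lfloor>R\<rfloor>" and "m \<equiv> max 2 (nat \<lceil>R / 4\<rceil>)"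
  shows "m \<le> N" and "sqrt R - 2 \<le> (\<Sum>k=m..N. 1 / sqrt (real k + 1))"
proof -
  have N: "real N \<le> R" "R < real N + 1" "N \<ge> 4"
    using R unfolding N_def by linarith+
  have m: "real m + 1 \<le> R / 4 + 2"
    using R unfolding m_def by linarith
  have "real m \<le> R / 4 + 1" using m by simp
  also have "\<dots> < real N" using N R by linarith
  finally show mN: "m \<le> N" by simp
  have "sqrt R \<le> sqrt (real N + 2)" using N by simp
  moreover have "2 * sqrt (real m + 1) \<le> sqrt R + 2"
  proof -
    have "sqrt R \<ge> sqrt 4" using R by (subst real_sqrt_le_iff)
    then have "4 * (real m + 1) \<le> (sqrt R + 2)\<^sup>2"
      using m R by (simp add: power2_sum)
    then have "sqrt (4 * (real m + 1)) \<le> sqrt R + 2"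
      using R by (intro real_le_lsqrt) auto
    moreover have "sqrt (4 * (real m + 1)) = 2 * sqrt (real m + 1)"
      unfolding real_sqrt_mult by simp
    ultimately show ?thesis by simp
  qed
  ultimately show "sqrt R - 2 \<le> (\<Sum>k=m..N. 1 / sqrt (real k + 1))"
    using sum_inverse_sqrt_ge[OF mN] unfolding right_diff_distrib by linarith
qed

text \<open>The bound 19/80 is what turns the increments of 1 / b into at most \<rho> / 4. The mean
  value theorem with the derivative at 1 would only give 1/4, hence the binomial expansion of (q +
  19/80)^4.\<close>

lemma powr_quarter_increment:
  fixes k :: real
  assumes "k \<ge> 1"
  shows "(k + 1) powr (1/4) - k powr (1/4) \<le> 19 / 80"
proof -
  define q where "q = k powr (1/4)"
  have q: "q \<ge> 1" using assms by (simp add: q_def ge_one_powr_ge_zero)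
  have q4: "q ^ 4 = k" using assms by (simp add: q_def powr_power)
  have "q ^ 3 \<ge> 1" "q ^ 2 \<ge> 1" using q by simp_all
  then have "q ^ 4 + 1 \<le> q ^ 4 + 19 / 20 * q ^ 3 + 6 * (19 / 80)\<^sup>2 * q ^ 2"
    by (simp add: power2_eq_square)
  moreover have "(q + 19 / 80) ^ 4 = q ^ 4 + 19 / 20 * q ^ 3 + 6 * (19 / 80)\<^sup>2 * q ^ 2 + 4 * (19 / 80) ^ 3 * q + (19 / 80) ^ 4"
    by (simp add: power4_eq_xxxx power2_eq_square power3_eq_cube field_simps)
  then have "q ^ 4 + 19 / 20 * q ^ 3 + 6 * (19 / 80)\<^sup>2 * q ^ 2 \<le> (q + 19 / 80) ^ 4"
    using q by simp
  ultimately have "k + 1 \<le> (q + 19 / 80) ^ 4" unfolding q4 by linarith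
  then have "(k + 1) powr (1/4) \<le> ((q + 19 / 80) ^ 4) powr (1/4)"
    using assms by (intro powr_mono2) auto
  also have "(q + 19 / 80) ^ 4 = (q + 19 / 80) powr 4"
    using q by (simp add: powr_numeral)
  also have "\<dots> powr (1/4) = (q + 19 / 80) powr (4 * (1/4))"
    by (rule powr_powr)
  also have "\<dots> = q + 19 / 80"
    using q by simp
  finally show ?thesis by (simp add: q_def)
qed

section \<open>Block vectors\<close>

lemma power2_norm_vec: "(norm u)\<^sup>2 = (\<Sum>i\<in>UNIV. (norm (u $ i))\<^sup>2)"
  for u :: "('a::real_inner, 'k::finite) vec"
  by (simp add: power2_norm_eq_inner inner_vec_def)

lemma convex_block_prod: "(\<And>i. convex (X i)) \<Longrightarrow> convex (block_prod X)"
  by (auto simp: convex_def block_prod_def)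

lemma compact_block_prod:
  fixes X :: "'k::finite \<Rightarrow> 'a::euclidean_space set"
  assumes "\<And>i. compact (X i)"
  shows "compact (block_prod X)"
proof -
  have "closed (block_prod X)"
  proof -
    have "closed {u. u $ i \<in> X i}" for i
      using continuous_closed_vimage[of "X i" "\<lambda>u. u $ i"] assms[of i]
      by (auto simp: compact_imp_closed vimage_def intro!: continuous_intros)
    then show ?thesis unfolding block_prod_def by (simp add: closed_Collect_all)
  qed
  moreover have "bounded (block_prod X)"
  proof -
    have "\<exists>B. \<forall>u\<in>X i. norm u \<le> B" for i
      using assms[of i] by (simp add: compact_imp_bounded flip: bounded_iff)
    then obtain B where B: "\<And>i u. u \<in> X i \<Longrightarrow> norm u \<le> B i" by metis
    have "norm u \<le> (\<Sum>i\<in>UNIV. B i)" if u: "u \<in> block_prod X" for u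
    proof -
      have "norm u \<le> (\<Sum>i\<in>UNIV. norm (u $ i))"
        unfolding norm_vec_def by (rule L2_set_le_sum) simp
      also have "\<dots> \<le> (\<Sum>i\<in>UNIV. B i)"
        using u by (intro sum_mono B) (simp add: block_prod_def)
      finally show ?thesis .
    qed
    then show ?thesis by (auto simp: bounded_iff)
  qed
  ultimately show ?thesis by (simp add: compact_eq_bounded_closed)
qed

lemma partial_update_in_block_prod:
  "new \<in> block_prod X \<Longrightarrow> old \<in> block_prod X \<Longrightarrow> partial_update new old i \<in> block_prod X"
  by (auto simp: block_prod_def partial_update_def)

lemma partial_update_single:
  fixes old :: "('a, 'k::{finite,linorder}) vec"
  assumes "CARD('k) = 1"
  shows "partial_update new old i = old"
proof -
  have "i' = i" for i' :: 'k
    using assms by (metis UNIV_I card_1_singletonE singletonD)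
  then have "\<not> i' < i" for i' by (metis order.irrefl)
  then show ?thesis
    by (simp add: partial_update_def vec_eq_iff)
qed

lemma norm_partial_update_diff_le:
  fixes new old :: "('a::real_normed_vector, 'k::{finite,linorder}) vec"
  shows "norm (partial_update new old i - old) \<le> norm (new - old)"
  unfolding norm_vec_def by (rule L2_set_mono) (auto simp: partial_update_def)

text \<open>Blocks are exchanged one at a time in index order. The induction runs over downward
  closed sets of exchanged indices: if the maximum \<open>j\<close> is added to such a set, the set
  before was exactly {i. i < j}, so its mixture is \<open>partial_update new old j\<close>.\<close>

lemma partial_update_telescope:
  fixes F :: "('a::real_vector, 'k::{finite,linorder}) vec \<Rightarrow> real"
  shows "F new - F old = (\<Sum>j\<in>UNIV. F (partial_update new old j + axis j (new $ j - old $ j))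
      - F (partial_update new old j))"
proof -
  define mix where "mix A = (\<chi> i. if i \<in> A then new $ i else old $ i)" for A
  have "(\<forall>i\<in>A. \<forall>i'<i. i' \<in> A) \<longrightarrow> F (mix A) - F old =
      (\<Sum>j\<in>A. F (partial_update new old j + axis j (new $ j - old $ j)) - F (partial_update new old j))" for A
    using finite[of A]
  proof (induction A rule: finite_linorder_max_induct)
    case empty
    show ?case by (simp add: mix_def)
  next
    case (insert j A)
    show ?case
    proof
      assume down: "\<forall>i\<in>insert j A. \<forall>i'<i. i' \<in> insert j A"
      have A: "A = {i. i < j}" using down insert by auto
      have "mix A = partial_update new old j"
        by (simp add: mix_def A partial_update_def)
      moreover have "mix (insert j A) = partial_update new old j + axis j (new $ j - old $ j)"
        by (auto simp: mix_def A partial_update_def vec_eq_iff axis_def)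
      moreover have "j \<notin> A" by (simp add: A)
      moreover have "\<forall>i\<in>A. \<forall>i'<i. i' \<in> A" using A by auto
      ultimately show "F (mix (insert j A)) - F old = (\<Sum>j\<in>insert j A.
          F (partial_update new old j + axis j (new $ j - old $ j)) - F (partial_update new old j))"
        using insert by simp
    qed
  qed
  from this[of UNIV] show ?thesis by (simp add: mix_def vec_nth_inverse)
qed

text \<open>Per block, the prox inequality turns the linear term minus the change of
  \<open>g\<close> into a gain of \<xi> times the squared step, and the lower descent bound loses L
  / 2 of it. This holds without concavity of \<open>F\<close>.\<close>

lemma block_ascent:
  fixes F :: "('a::real_inner, 'm::{finite,linorder}) vec \<Rightarrow> real"
  assumes F: "lipschitz_gradient_on F D (block_prod Y) L"
    and old: "old \<in> block_prod Y" and new: "new \<in> block_prod Y" and \<xi>: "\<xi> > 0"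
    and optimality: "\<And>j. g j (old $ j) - g j (new $ j) + \<xi> * ((new $ j -
      (old $ j + (1 / \<xi>) *\<^sub>R (D (partial_update new old j) $ j))) \<bullet> (old $ j - new $ j)) \<ge> 0"
  shows "(F new - (\<Sum>j\<in>UNIV. g j (new $ j))) - (F old - (\<Sum>j\<in>UNIV. g j (old $ j)))
    \<ge> (\<xi> - L / 2) * (norm (new - old))\<^sup>2"
proof -
  interpret lipschitz_gradient_on F D "block_prod Y" L by (rule F)
  let ?n = "\<lambda>j. (norm (new $ j - old $ j))\<^sup>2"
  have block: "(\<xi> - L / 2) * ?n j \<le> F (partial_update new old j + axis j (new $ j - old $ j))
      - F (partial_update new old j) - g j (new $ j) + g j (old $ j)" for j
  proof -
    let ?w = "partial_update new old j" and ?a = "axis j (new $ j - old $ j)"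
    have "?w \<in> block_prod Y" using new old by (rule partial_update_in_block_prod)
    moreover have "?w + ?a \<in> block_prod Y"
      using new old by (auto simp: block_prod_def partial_update_def axis_def)
    ultimately have "F (?w + ?a) \<ge> F ?w + D ?w $ j \<bullet> (new $ j - old $ j) - L / 2 * ?n j"
      using descent(2)[of ?w "?w + ?a"] by (simp add: inner_axis power2_norm_eq_inner)
    moreover have "\<xi> * ((new $ j - (old $ j + (1 / \<xi>) *\<^sub>R (D ?w $ j))) \<bullet> (old $ j - new $ j))
        = D ?w $ j \<bullet> (new $ j - old $ j) - \<xi> * ?n j"
      using \<xi> unfolding power2_norm_eq_inner
      by (simp add: inner_add_left inner_diff_left inner_diff_right algebra_simps)
    ultimately show ?thesis
      using optimality[of j] by (simp add: left_diff_distrib)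
  qed
  have "(\<xi> - L / 2) * (norm (new - old))\<^sup>2 = (\<Sum>j\<in>UNIV. (\<xi> - L / 2) * ?n j)"
    by (simp add: power2_norm_vec sum_distrib_left)
  also have "\<dots> \<le> (\<Sum>j\<in>UNIV. F (partial_update new old j + axis j (new $ j - old $ j))
      - F (partial_update new old j) - g j (new $ j) + g j (old $ j))"
    by (intro sum_mono block)
  also have "\<dots> = (F new - F old) - (\<Sum>j\<in>UNIV. g j (new $ j)) + (\<Sum>j\<in>UNIV. g j (old $ j))"
    unfolding partial_update_telescope[of F new old] by (simp add: sum.distrib sum_subtractf)
  finally show ?thesis by simp
qed

section \<open>The algorithm\<close>

text \<open>\<open>\<xi> k\<close> is the step parameter \<iota> + \<theta> k of the theorem with
  the two \<iota> terms combined. The x part has one block, the y part CARD('m) blocks.\<close>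

locale convex_nonconcave_bapg =
  fixes f :: "('a::euclidean_space, 'k::{finite,linorder}) vec \<times> ('b::euclidean_space, 'm::{finite,linorder}) vec \<Rightarrow> real"
    and h :: "'k \<Rightarrow> 'a \<Rightarrow> real" and g :: "'m \<Rightarrow> 'b \<Rightarrow> real"
    and X :: "'k \<Rightarrow> 'a set" and Y :: "'m \<Rightarrow> 'b set"
    and x :: "nat \<Rightarrow> ('a, 'k) vec" and y :: "nat \<Rightarrow> ('b, 'm) vec"
    and L11 L12 L21 L22 \<rho> \<iota> \<tau> :: real and b \<xi> p :: "nat \<Rightarrow> real"
  assumes single_block: "CARD('k) = 1"
    and X: "\<And>i. X i \<noteq> {}" "\<And>i. compact (X i)" "\<And>i. convex (X i)"
    and Y: "\<And>j. Y j \<noteq> {}" "\<And>j. compact (Y j)" "\<And>j. convex (Y j)"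
    and f: "continuously_differentiable f"
    and h: "\<And>i. convex_on UNIV (h i)" "\<And>i. continuous_on UNIV (h i)"
    and g: "\<And>j. convex_on UNIV (g j)" "\<And>j. continuous_on UNIV (g j)"
    and f_convex: "\<And>v. v \<in> block_prod Y \<Longrightarrow> convex_on (block_prod X) (\<lambda>u. f (u, v))"
    and L_pos: "L11 > 0" "L12 > 0" "L21 > 0" "L22 > 0"
    and f_lipschitz: "lipschitz_gradient f (block_prod X) (block_prod Y) L11 L12 L21 L22"
    and \<rho>: "\<rho> > 0" "\<rho> \<le> 1 / (10 * L11)"
    and \<iota>: "\<iota> > 0"
    and b_def: "b = (\<lambda>k. 19 / (20 * \<rho> * real k powr (1/4)))"
    and \<tau>: "\<tau> > 2" "\<tau> > \<rho> * (b 2)\<^sup>2 * (L22 + 2 * \<iota> - \<rho> * L21\<^sup>2) / (16 * L21\<^sup>2)"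
    and \<xi>_def: "\<xi> = (\<lambda>k. \<rho> * L21\<^sup>2 + 16 * \<tau> * L21\<^sup>2 / (\<rho> * (b (k + 1))\<^sup>2) - \<iota>)"
    and p_def: "p = (\<lambda>k. 8 * (\<tau> - 2) * L21\<^sup>2 / (\<rho> * (b (k + 1))\<^sup>2))"
    and xy: "bapg f h g X Y (\<lambda>k i. 1 / \<rho>) (\<lambda>k j. \<xi> k) b (\<lambda>k. 0) x y"
begin

section \<open>Properties of the parameter sequences and of the partial gradients\<close>

lemma b_pos: "k \<ge> 1 \<Longrightarrow> b k > 0"
  using \<rho> by (simp add: b_def)

lemma b_antimono: "1 \<le> k \<Longrightarrow> k \<le> k' \<Longrightarrow> b k' \<le> b k"
  using \<rho> unfolding b_def
  by (intro divide_left_mono mult_left_mono mult_pos_pos powr_mono2) auto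

lemma b_le: "k \<ge> 1 \<Longrightarrow> b k \<le> 19 / (20 * \<rho>)"
  using b_antimono[of 1 k] by (simp add: b_def)

lemma b_square: "(b k)\<^sup>2 = 19\<^sup>2 / (20\<^sup>2 * \<rho>\<^sup>2 * sqrt k)"
proof -
  have "(real k powr (1/4))\<^sup>2 = sqrt k"
    by (cases "k = 0") (simp_all add: powr_half_sqrt powr_powr flip: powr_realpow)
  then show ?thesis by (simp add: b_def power_divide power_mult_distrib)
qed

lemma b_inverse_diff: "k \<ge> 1 \<Longrightarrow> 1 / b (k + 1) - 1 / b k \<le> \<rho> / 4"
proof -
  assume k: "k \<ge> 1"
  have "1 / b (k + 1) - 1 / b k = 20 * \<rho> / 19 * ((real k + 1) powr (1/4) - real k powr (1/4))"
    by (simp add: b_def field_simps add.commute)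
  also have "\<dots> \<le> 20 * \<rho> / 19 * (19 / 80)"
    using k \<rho> by (intro mult_left_mono powr_quarter_increment) auto
  finally show ?thesis by simp
qed

lemma b_ratio: "k \<ge> 2 \<Longrightarrow> b (k - 1) / b k = (real k / (real k - 1)) powr (1/4)"
  using \<rho> by (simp add: b_def powr_divide of_nat_diff)

lemma b_ratio_decreasing: "k \<ge> 2 \<Longrightarrow> b k / b (k + 1) \<le> b (k - 1) / b k"
proof -
  assume k: "k \<ge> 2"
  have "(real k + 1) / real k \<le> real k / (real k - 1)"
    using k by (simp add: field_simps)
  then have "((real k + 1) / real k) powr (1/4) \<le> (real k / (real k - 1)) powr (1/4)"
    using k by (intro powr_mono2) auto
  then show ?thesis using b_ratio[of k] b_ratio[of "k + 1"] k by (simp add: add.commute)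
qed

lemma b_ratio_ge_1: "k \<ge> 2 \<Longrightarrow> 1 \<le> b (k - 1) / b k"
  using b_antimono[of "k - 1" k] b_pos[of k] by (simp add: le_divide_eq)

lemma L11_le: "L11 \<le> 1 / (10 * \<rho>)"
  using \<rho> L_pos by (simp add: field_simps)

lemma differentiable: "f differentiable (at z)"
  using f unfolding continuously_differentiable_def by blast

lemma lipschitz:
  assumes "u \<in> block_prod X" "u' \<in> block_prod X" "v \<in> block_prod Y" "v' \<in> block_prod Y"
  shows "norm (grad_x f u v - grad_x f u' v) \<le> L11 * norm (u - u')"
    and "norm (grad_x f u v - grad_x f u v') \<le> L21 * norm (v - v')"
    and "norm (grad_y f u v - grad_y f u v') \<le> L22 * norm (v - v')"
    and "norm (grad_y f u v - grad_y f u' v) \<le> L12 * norm (u - u')"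
  using f_lipschitz assms unfolding lipschitz_gradient_def by blast+

lemma primal_gradient:
  assumes "v \<in> block_prod Y"
  shows "convex_lipschitz_gradient_on (\<lambda>u. f (u, v)) (\<lambda>u. grad_x f u v) (block_prod X) L11"
  using assms L_pos X
  by unfold_locales (auto intro!: GDERIV_grad_x differentiable lipschitz f_convex convex_block_prod)

lemma dual_gradient:
  assumes "u \<in> block_prod X"
  shows "lipschitz_gradient_on (\<lambda>v. f (u, v)) (grad_y f u) (block_prod Y) L22"
  using assms L_pos Y
  by unfold_locales (auto intro!: GDERIV_grad_y differentiable lipschitz convex_block_prod)

lemma \<tau>_bound: "k \<ge> 2 \<Longrightarrow> 16 * \<tau> * L21\<^sup>2 / (\<rho> * (b k)\<^sup>2) > L22 + 2 * \<iota> - \<rho> * L21\<^sup>2"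
proof -
  assume k: "k \<ge> 2"
  have "\<rho> * (b 2)\<^sup>2 * (L22 + 2 * \<iota> - \<rho> * L21\<^sup>2) < 16 * \<tau> * L21\<^sup>2"
    using \<tau>(2) L_pos by (simp add: divide_less_eq mult_ac)
  then have "L22 + 2 * \<iota> - \<rho> * L21\<^sup>2 < 16 * \<tau> * L21\<^sup>2 / (\<rho> * (b 2)\<^sup>2)"
    using \<rho> b_pos[of 2] by (simp add: less_divide_eq mult_ac)
  also have "\<dots> \<le> 16 * \<tau> * L21\<^sup>2 / (\<rho> * (b k)\<^sup>2)"
    using \<rho> \<tau> b_pos[of 2] b_pos[of k] b_antimono[of 2 k] k
    by (intro divide_left_mono mult_left_mono mult_pos_pos power_mono) auto
  finally show ?thesis .
qed

lemma \<xi>_gt: "k \<ge> 1 \<Longrightarrow> \<xi> k > L22 + \<iota>"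
  using \<tau>_bound[of "k + 1"] by (simp add: \<xi>_def)

lemma \<xi>_pos: "k \<ge> 1 \<Longrightarrow> \<xi> k > 0"
  using \<xi>_gt[of k] L_pos \<iota> by linarith

section \<open>Feasibility and optimality conditions of the iterates\<close>

lemma proximal_h: "proximal (h i) (X i) (1 / \<rho>)"
  using X h \<rho> by unfold_locales (auto intro: convex_on_subset[OF _ subset_UNIV] continuous_on_subset[OF _ subset_UNIV])

lemma proximal_g: "k \<ge> 1 \<Longrightarrow> proximal (g j) (Y j) (\<xi> k)"
  using Y g \<xi>_pos by unfold_locales (auto intro: convex_on_subset[OF _ subset_UNIV] continuous_on_subset[OF _ subset_UNIV])

lemma x_Suc:
  assumes "k \<ge> 1"
  shows "x (k + 1) $ i = prox_min (h i) (X i) (1 / \<rho>)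
    (x k $ i - \<rho> *\<^sub>R (grad_x f (x k) (y k) $ i) - (\<rho> * b k) *\<^sub>R (x k $ i))"
  using xy assms unfolding bapg_def partial_update_single[OF single_block] by simp

lemma y_Suc:
  assumes "k \<ge> 1"
  shows "y (k + 1) $ j = prox_min (g j) (Y j) (\<xi> k)
    (y k $ j + (1 / \<xi> k) *\<^sub>R (grad_y f (x (k + 1)) (partial_update (y (k + 1)) (y k) j) $ j))"
  using xy assms unfolding bapg_def prox_max_eq_prox_min by simp

lemma x_in: "k \<ge> 1 \<Longrightarrow> x k \<in> block_prod X"
proof (induction k rule: dec_induct)
  case base
  then show ?case using xy by (simp add: bapg_def)
next
  case (step n)
  then show ?case
    using x_Suc[of n] proximal.prox_in[OF proximal_h] by (simp add: block_prod_def)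
qed

lemma y_in: "k \<ge> 1 \<Longrightarrow> y k \<in> block_prod Y"
proof (induction k rule: dec_induct)
  case base
  then show ?case using xy by (simp add: bapg_def)
next
  case (step n)
  then show ?case
    using y_Suc[of n] proximal.prox_in[OF proximal_g] by (simp add: block_prod_def)
qed

lemma x_variational:
  assumes k: "k \<ge> 1" and u: "u \<in> block_prod X"
  shows "(\<Sum>i\<in>UNIV. h i (u $ i)) - (\<Sum>i\<in>UNIV. h i (x (k + 1) $ i)) +
    ((1 / \<rho>) *\<^sub>R (x (k + 1) - x k) + grad_x f (x k) (y k) + b k *\<^sub>R x k) \<bullet> (u - x (k + 1)) \<ge> 0"
proof -
  let ?v = "(1 / \<rho>) *\<^sub>R (x (k + 1) - x k) + grad_x f (x k) (y k) + b k *\<^sub>R x k"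
  have "0 \<le> h i (u $ i) - h i (x (k + 1) $ i) + (?v $ i) \<bullet> (u $ i - x (k + 1) $ i)" for i
  proof -
    let ?z = "x k $ i - \<rho> *\<^sub>R (grad_x f (x k) (y k) $ i) - (\<rho> * b k) *\<^sub>R (x k $ i)"
    have "?v $ i = (1 / \<rho>) *\<^sub>R (x (k + 1) $ i - ?z)"
      using \<rho> by (simp add: algebra_simps)
    then show ?thesis
      using proximal.prox_variational[OF proximal_h, of "u $ i" i ?z] u
      unfolding x_Suc[OF k, of i, symmetric] by (simp add: block_prod_def)
  qed
  then have "0 \<le> (\<Sum>i\<in>UNIV. h i (u $ i) - h i (x (k + 1) $ i) + (?v $ i) \<bullet> (u $ i - x (k + 1) $ i))"
    by (rule sum_nonneg)
  then show ?thesis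
    by (simp add: sum.distrib sum_subtractf inner_vec_def)
qed

lemma y_ascent:
  assumes k: "k \<ge> 1"
  shows "objective f h g (x (k + 1)) (y (k + 1)) - objective f h g (x (k + 1)) (y k)
    \<ge> (\<xi> k - L22 / 2) * (norm (y (k + 1) - y k))\<^sup>2"
proof -
  have "0 \<le> g j (y k $ j) - g j (y (k + 1) $ j) + \<xi> k * ((y (k + 1) $ j -
      (y k $ j + (1 / \<xi> k) *\<^sub>R (grad_y f (x (k + 1)) (partial_update (y (k + 1)) (y k) j) $ j)))
      \<bullet> (y k $ j - y (k + 1) $ j))" for j
    using proximal.prox_variational[OF proximal_g[OF k], of "y k $ j" j] y_in[OF k]
    unfolding y_Suc[OF k, of j] by (simp add: block_prod_def)
  then have "(\<xi> k - L22 / 2) * (norm (y (k + 1) - y k))\<^sup>2 \<le>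
      (f (x (k + 1), y (k + 1)) - (\<Sum>j\<in>UNIV. g j (y (k + 1) $ j)))
      - (f (x (k + 1), y k) - (\<Sum>j\<in>UNIV. g j (y k $ j)))"
    using k by (intro block_ascent[OF dual_gradient] x_in y_in \<xi>_pos) auto
  then show ?thesis by (simp add: objective_def)
qed

abbreviation "l \<equiv> objective f h g"
text \<open>\<open>A k\<close> and \<open>c k\<close> are the prices that
  \<open>minimization_step\<close> sets on the last y step and on the change of the squared norm of
  x, for M = L21, b0 = b (k - 1) and b1 = b k.\<close>

abbreviation "A k \<equiv> \<rho> * L21\<^sup>2 / 2 + 16 * L21\<^sup>2 / (\<rho> * (b k)\<^sup>2)"
abbreviation "c k \<equiv> b (k - 1) / 2 + 4 / \<rho> * (b (k - 1) / b k - 1)"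

text \<open>The \<open>h\<close> difference is bounded by the optimality condition of step k - 1
  tested at x (k + 1), which brings in the gradient at the previous iterates and requires k \<ge> 2.
  Adding the condition of step k tested at x k cancels \<open>h\<close> and gives the second input
  of \<open>minimization_step\<close>.\<close>

lemma x_step:
  assumes k: "k \<ge> 2"
  shows "l (x (k + 1)) (y k) - l (x k) (y k) \<ge>
    4 / (\<rho>\<^sup>2 * b k) * ((norm (x (k + 1) - x k))\<^sup>2 - (norm (x k - x (k - 1)))\<^sup>2)
    - A k * (norm (y k - y (k - 1)))\<^sup>2
    - c k * ((norm (x (k + 1)))\<^sup>2 - (norm (x k))\<^sup>2)
    + 2 / \<rho> * (norm (x (k + 1) - x k))\<^sup>2 + 2 / \<rho> * (norm (x k - x (k - 1)))\<^sup>2"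
proof -
  define s d where "s = x (k + 1) - x k" and "d = x k - x (k - 1)"
  \<comment> \<open>The gradient change is split at (x k, y (k - 1)), so that \<open>D2\<close> is a
    gradient difference of the single convex function f(., y (k - 1)), to which
    \<open>three_point\<close> applies.\<close>
  define D1 where "D1 = grad_x f (x k) (y k) - grad_x f (x k) (y (k - 1))"
  define D2 where "D2 = grad_x f (x k) (y (k - 1)) - grad_x f (x (k - 1)) (y (k - 1))"
  define H where "H u = (\<Sum>i\<in>UNIV. h i (u $ i))" for u :: "('a, 'k) vec"
  have mem: "x k \<in> block_prod X" "x (k - 1) \<in> block_prod X" "x (k + 1) \<in> block_prod X"
    "y k \<in> block_prod Y" "y (k - 1) \<in> block_prod Y"
    using k by (auto intro!: x_in y_in)
  have [simp]: "k - 1 + 1 = k" using k by simp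
  interpret cur: convex_lipschitz_gradient_on "\<lambda>u. f (u, y k)" "\<lambda>u. grad_x f u (y k)" "block_prod X" L11
    using mem by (intro primal_gradient)
  interpret prev: convex_lipschitz_gradient_on "\<lambda>u. f (u, y (k - 1))" "\<lambda>u. grad_x f u (y (k - 1))"
    "block_prod X" L11
    using mem by (intro primal_gradient)
  have x_eq: "x (k - 1) + d = x k" "x (k - 1) + d + s = x (k + 1)"
    by (simp_all add: s_def d_def)
  have grad_eq: "grad_x f (x k) (y k) = grad_x f (x (k - 1)) (y (k - 1)) + (D1 + D2)"
    by (simp add: D1_def D2_def)
  have vi_prev: "0 \<le> H (x (k + 1)) - H (x k) +
      ((1 / \<rho>) *\<^sub>R d + grad_x f (x (k - 1)) (y (k - 1)) + b (k - 1) *\<^sub>R x (k - 1)) \<bullet> s"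
    using x_variational[of "k - 1" "x (k + 1)"] k mem by (simp add: H_def s_def d_def)
  have vi_cur: "0 \<le> H (x k) - H (x (k + 1)) +
      ((1 / \<rho>) *\<^sub>R s + grad_x f (x k) (y k) + b k *\<^sub>R x k) \<bullet> (- s)"
    using x_variational[of k "x k"] k mem by (simp add: H_def s_def)
  have "4 / (\<rho>\<^sup>2 * b k) * ((norm s)\<^sup>2 - (norm d)\<^sup>2)
      - A k * (norm (y k - y (k - 1)))\<^sup>2
      - c k * ((norm (x (k - 1) + d + s))\<^sup>2 - (norm (x (k - 1) + d))\<^sup>2)
      + 2 / \<rho> * (norm s)\<^sup>2 + 2 / \<rho> * (norm d)\<^sup>2 \<le> l (x (k + 1)) (y k) - l (x k) (y k)"
  proof (rule minimization_step)
    show "\<rho> > 0" "b k > 0" "b k \<le> b (k - 1)" "b (k - 1) \<le> 19 / (20 * \<rho>)"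
      using k \<rho> b_pos b_antimono[of "k - 1" k] b_le[of "k - 1"] by auto
    show "L11 \<le> 1 / (10 * \<rho>)" by (rule L11_le)
    have "f (x (k + 1), y k) - f (x k, y k) \<ge> grad_x f (x k) (y k) \<bullet> s"
      using cur.first_order[OF mem(1,3)] by (simp add: s_def)
    moreover have "H (x (k + 1)) - H (x k) \<ge> - (d \<bullet> s / \<rho>) - grad_x f (x (k - 1)) (y (k - 1)) \<bullet> s
        - b (k - 1) * (x (k - 1) \<bullet> s)"
      using vi_prev by (simp add: inner_add_left)
    ultimately show "(D1 + D2) \<bullet> s - d \<bullet> s / \<rho> - b (k - 1) * (x (k - 1) \<bullet> s)
        \<le> l (x (k + 1)) (y k) - l (x k) (y k)"
      unfolding grad_eq by (simp add: objective_def H_def inner_add_left)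
    show "((1 / \<rho>) *\<^sub>R (s - d) + (D1 + D2) + b k *\<^sub>R (x (k - 1) + d) - b (k - 1) *\<^sub>R x (k - 1)) \<bullet> s \<le> 0"
      using vi_prev vi_cur unfolding grad_eq x_eq
      by (simp add: inner_add_left inner_diff_left diff_divide_distrib)
    show "- (L11 / 4) * (norm (s - d))\<^sup>2 \<le> D2 \<bullet> s"
      using prev.three_point[OF mem(2,1,3)] by (simp add: D2_def s_def d_def)
    show "norm D1 \<le> L21 * norm (y k - y (k - 1))"
      using lipschitz(2)[of "x k" "x k" "y k" "y (k - 1)"] mem by (simp add: D1_def)
  qed
  then show ?thesis unfolding x_eq(2) unfolding x_eq(1) by (simp only: s_def d_def)
qed

lemma p_pos: "k \<ge> 1 \<Longrightarrow> p k > 0"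
  using \<tau> \<rho> L_pos b_pos[of "k + 1"] by (simp add: p_def)

text \<open>The gain of the y step is divided: \<open>A (k + 1)\<close> pays for the loss in the
  next x step, and \<open>p k\<close> is kept. The inequality amounts to half of
  \<open>\<tau>_bound\<close> at index k + 1.\<close>

lemma p_le: "k \<ge> 1 \<Longrightarrow> p k + A (k + 1) \<le> \<xi> k - L22 / 2"
proof -
  assume k: "k \<ge> 1"
  define t where "t = L21\<^sup>2 / (\<rho> * (b (k + 1))\<^sup>2)"
  have "16 * \<tau> * t > L22 + 2 * \<iota> - \<rho> * L21\<^sup>2"
    using \<tau>_bound[of "k + 1"] k by (simp add: t_def)
  moreover have "p k = 8 * \<tau> * t - 16 * t" "A (k + 1) = \<rho> * L21\<^sup>2 / 2 + 16 * t"
    "\<xi> k = \<rho> * L21\<^sup>2 + 16 * \<tau> * t - \<iota>"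
    by (simp_all add: p_def \<xi>_def t_def left_diff_distrib right_diff_distrib diff_divide_distrib)
  ultimately show ?thesis by linarith
qed

section \<open>Bounds on the feasible set and the summed energy estimate\<close>

abbreviation "\<delta> \<equiv> SUP u\<in>block_prod X. norm u"
abbreviation "l_max \<equiv> SUP (u, v)\<in>block_prod X \<times> block_prod Y. l u v"

lemma norm_le_\<delta>: "u \<in> block_prod X \<Longrightarrow> norm u \<le> \<delta>"
  using compact_imp_bounded[OF compact_block_prod[of X]] X
  by (intro cSUP_upper) (auto simp: bdd_above_norm)

lemma l_le_l_max:
  assumes "u \<in> block_prod X" "v \<in> block_prod Y"
  shows "l u v \<le> l_max"
proof -
  have "continuous_on UNIV f"
    using differentiable by (auto intro!: continuous_at_imp_continuous_on differentiable_imp_continuous_within)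
  then have "continuous_on UNIV (\<lambda>z. l (fst z) (snd z))"
    unfolding objective_def
    by (intro continuous_intros continuous_on_compose2[OF h(2)] continuous_on_compose2[OF g(2)]) auto
  then have "compact ((\<lambda>z. l (fst z) (snd z)) ` (block_prod X \<times> block_prod Y))"
    using X Y by (intro compact_continuous_image compact_Times compact_block_prod)
      (auto intro: continuous_on_subset)
  then have "bdd_above ((\<lambda>(u, v). l u v) ` (block_prod X \<times> block_prod Y))"
    by (simp add: bounded_imp_bdd_above compact_imp_bounded case_prod_unfold)
  then show ?thesis
    using assms cSUP_upper[of "(u, v)" "block_prod X \<times> block_prod Y" "\<lambda>(u, v). l u v"] by simp
qed

lemma energy:
  assumes N: "N \<ge> 1"
  shows "(\<Sum>k=2..N. p k * (norm (y (k + 1) - y k))\<^sup>2 + 3 / \<rho> * (norm (x (k + 1) - x k))\<^sup>2) \<le>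
    l_max - l (x 2) (y 2) + 16 * \<delta>\<^sup>2 / (\<rho>\<^sup>2 * b 2) + A 2 * (norm (y 2 - y 1))\<^sup>2 + 8 * \<delta>\<^sup>2 / \<rho> + c 2 * \<delta>\<^sup>2"
proof -
  define s where "s k = (norm (x k - x (k - 1)))\<^sup>2" for k
  define e where "e k = (norm (y k - y (k - 1)))\<^sup>2" for k
  have "(\<Sum>k=2..N. p k * e (k + 1) + 3 / \<rho> * s (k + 1)) \<le>
    l_max - l (x 2) (y 2) + 16 * \<delta>\<^sup>2 / (\<rho>\<^sup>2 * b 2) + A 2 * e 2 + 8 * \<delta>\<^sup>2 / \<rho> + c 2 * \<delta>\<^sup>2"
  proof (rule energy_sum[where l = "\<lambda>k. l (x k) (y k)" and A = "\<lambda>k. A k" and \<nu> = "\<lambda>k. (norm (x k))\<^sup>2"])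
    fix k :: nat assume k: "k \<ge> 2"
    show "1 / b (k + 1) - 1 / b k \<le> \<rho> / 4" using b_inverse_diff[of k] k by simp
    have "b k \<le> b (k - 1)" using b_antimono[of "k - 1" k] k by simp
    moreover have "4 / \<rho> * (b k / b (k + 1) - 1) \<le> 4 / \<rho> * (b (k - 1) / b k - 1)"
      using b_ratio_decreasing[OF k] \<rho> by (intro mult_left_mono) auto
    ultimately show "b (k + 1 - 1) / 2 + 4 / \<rho> * (b (k + 1 - 1) / b (k + 1) - 1) \<le> c k" by simp
    have "b (k - 1) > 0" using k by (intro b_pos) simp
    then show "0 \<le> c k"
      using b_ratio_ge_1[OF k] \<rho> k by (intro add_nonneg_nonneg mult_nonneg_nonneg) auto
    show "0 \<le> A k" using \<rho> by simp
    show "l (x k) (y k) \<le> l_max" using k by (intro l_le_l_max x_in y_in) auto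
    have xk: "x k \<in> block_prod X" "x (k - 1) \<in> block_prod X" using k by (auto intro!: x_in)
    show "(norm (x k))\<^sup>2 \<le> \<delta>\<^sup>2" using norm_le_\<delta>[OF xk(1)] by (intro power_mono) auto
    have "norm (x k - x (k - 1)) \<le> 2 * \<delta>"
      using norm_triangle_ineq4[of "x k" "x (k - 1)"] norm_le_\<delta>[OF xk(1)] norm_le_\<delta>[OF xk(2)] by linarith
    then have "s k \<le> (2 * \<delta>)\<^sup>2" unfolding s_def by (intro power_mono) auto
    then show "s k \<le> 4 * \<delta>\<^sup>2" by (simp add: power_mult_distrib)
    have "(p k + A (k + 1)) * e (k + 1) \<le> (\<xi> k - L22 / 2) * e (k + 1)"
      using p_le[of k] k unfolding e_def by (intro mult_right_mono) auto
    then show "l (x (k + 1)) (y (k + 1)) - l (x k) (y k) \<ge>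
        4 / (\<rho>\<^sup>2 * b k) * (s (k + 1) - s k) - A k * e k - c k * ((norm (x (k + 1)))\<^sup>2 - (norm (x k))\<^sup>2)
        + 2 / \<rho> * s (k + 1) + 2 / \<rho> * s k + (p k + A (k + 1)) * e (k + 1)"
      using x_step[OF k] y_ascent[of k] k unfolding s_def e_def by (simp only: add_diff_cancel_right') linarith
  qed (use \<rho> N b_pos in \<open>auto simp: s_def e_def\<close>)
  then show ?thesis by (simp add: s_def e_def)
qed

section \<open>The stationarity gap in terms of the steps\<close>

abbreviation "G k \<equiv> stationarity_gap f h g X Y (\<lambda>i. 1 / \<rho>) (\<lambda>j. \<xi> k) (x k) (y k)"

text \<open>With a single block, the prox in the gap and the actual step differ only by the shift
  \<rho> b k x k of the argument, which nonexpansiveness passes on; the factor 1 / \<rho> makes it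
  the bias b k * \<delta>.\<close>

lemma gap_x:
  assumes k: "k \<ge> 1"
  shows "norm (fst (G k)) \<le> 1 / \<rho> * norm (x (k + 1) - x k) + b k * \<delta>"
proof -
  define P where "P = (\<chi> i. prox_min (h i) (X i) (1 / \<rho>) (x k $ i - \<rho> *\<^sub>R (grad_x f (x k) (y k) $ i)))"
  have G: "fst (G k) = (1 / \<rho>) *\<^sub>R (x k - P)"
    by (simp add: stationarity_gap_def P_def vec_eq_iff)
  have "norm ((x (k + 1) - P) $ i) \<le> norm (((\<rho> * b k) *\<^sub>R x k) $ i)" for i
  proof -
    have "norm ((x (k + 1) - P) $ i) \<le> norm ((x k $ i - \<rho> *\<^sub>R (grad_x f (x k) (y k) $ i) - (\<rho> * b k) *\<^sub>R (x k $ i))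
        - (x k $ i - \<rho> *\<^sub>R (grad_x f (x k) (y k) $ i)))"
      using proximal.prox_nonexpansive[OF proximal_h] by (simp only: x_Suc[OF k] P_def vector_minus_component vec_lambda_beta)
    then show ?thesis by simp
  qed
  then have "norm (x (k + 1) - P) \<le> norm ((\<rho> * b k) *\<^sub>R x k)"
    unfolding norm_vec_def by (intro L2_set_mono) auto
  also have "\<dots> \<le> \<rho> * b k * \<delta>"
    using \<rho> b_pos[OF k] norm_le_\<delta>[OF x_in[OF k]] by (simp add: mult_left_mono)
  finally have "norm (x k - P) \<le> norm (x (k + 1) - x k) + \<rho> * b k * \<delta>"
    using norm_triangle_ineq4[of "x (k + 1) - P" "x (k + 1) - x k"] by simp
  then have "1 / \<rho> * norm (x k - P) \<le> 1 / \<rho> * (norm (x (k + 1) - x k) + \<rho> * b k * \<delta>)"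
    using \<rho> by (intro mult_left_mono) auto
  then show ?thesis
    using \<rho> unfolding G by (simp add: distrib_left add_divide_distrib)
qed

text \<open>The actual step evaluates the gradient at the new x and partly new y, which costs the
  L12 and L22 terms. Each block is bounded by the full steps, hence the factor CARD('m) after
  squaring and summing.\<close>

lemma gap_y:
  assumes k: "k \<ge> 1"
  shows "norm (snd (G k) $ j) \<le> (\<xi> k + L22) * norm (y (k + 1) - y k) + L12 * norm (x (k + 1) - x k)"
proof -
  define P where "P = prox_min (g j) (Y j) (\<xi> k) (y k $ j + (1 / \<xi> k) *\<^sub>R (grad_y f (x k) (y k) $ j))"
  let ?w = "partial_update (y (k + 1)) (y k) j"
  let ?a = "grad_y f (x (k + 1)) ?w" and ?b = "grad_y f (x k) (y k)"
  have \<xi>: "\<xi> k > 0" using k by (rule \<xi>_pos)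
  have mem: "x k \<in> block_prod X" "x (k + 1) \<in> block_prod X" "y k \<in> block_prod Y" "?w \<in> block_prod Y"
    using k by (auto intro!: x_in y_in partial_update_in_block_prod)
  have "norm (?a - ?b) \<le> norm (grad_y f (x (k + 1)) ?w - grad_y f (x (k + 1)) (y k))
      + norm (grad_y f (x (k + 1)) (y k) - ?b)"
    by (rule order.trans[OF _ norm_triangle_ineq]) simp
  also have "\<dots> \<le> L22 * norm (?w - y k) + L12 * norm (x (k + 1) - x k)"
    using mem by (intro add_mono lipschitz) auto
  also have "\<dots> \<le> L22 * norm (y (k + 1) - y k) + L12 * norm (x (k + 1) - x k)"
    using L_pos by (intro add_right_mono mult_left_mono norm_partial_update_diff_le) auto
  finally have grad: "norm (?a - ?b) \<le> L22 * norm (y (k + 1) - y k) + L12 * norm (x (k + 1) - x k)" .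
  have "norm (y (k + 1) $ j - P) \<le> norm ((y k $ j + (1 / \<xi> k) *\<^sub>R (?a $ j)) - (y k $ j + (1 / \<xi> k) *\<^sub>R (?b $ j)))"
    unfolding y_Suc[OF k, of j] P_def by (rule proximal.prox_nonexpansive[OF proximal_g[OF k]])
  also have "\<dots> = 1 / \<xi> k * norm ((?a - ?b) $ j)"
    using \<xi> by (simp flip: scaleR_right_diff_distrib)
  also have "\<dots> \<le> 1 / \<xi> k * norm (?a - ?b)"
    using \<xi> by (intro mult_left_mono Finite_Cartesian_Product.norm_nth_le) auto
  finally have "\<xi> k * norm (y (k + 1) $ j - P) \<le> norm (?a - ?b)"
    using \<xi> by (simp add: field_simps)
  moreover have "norm (y k $ j - P) \<le> norm (y (k + 1) - y k) + norm (y (k + 1) $ j - P)"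
  proof -
    have "norm (y k $ j - P) \<le> norm ((y (k + 1) - y k) $ j) + norm (y (k + 1) $ j - P)"
      using norm_triangle_ineq4[of "y (k + 1) $ j - P" "y (k + 1) $ j - y k $ j"] by simp
    also have "norm ((y (k + 1) - y k) $ j) \<le> norm (y (k + 1) - y k)"
      by (rule Finite_Cartesian_Product.norm_nth_le)
    finally show ?thesis by simp
  qed
  then have "\<xi> k * norm (y k $ j - P) \<le> \<xi> k * (norm (y (k + 1) - y k) + norm (y (k + 1) $ j - P))"
    using \<xi> by (intro mult_left_mono) auto
  moreover have "norm (snd (G k) $ j) = \<xi> k * norm (y k $ j - P)"
    using \<xi> by (simp add: stationarity_gap_def P_def prox_max_eq_prox_min)
  ultimately show ?thesis
    using grad by (simp add: distrib_left distrib_right)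
qed

lemma gap_square:
  assumes k: "k \<ge> 1"
  shows "(norm (G k))\<^sup>2 \<le> 3 / 2 * ((b k)\<^sup>2 * \<delta>\<^sup>2)
    + (3 / \<rho>\<^sup>2 + 2 * real CARD('m) * L12\<^sup>2) * (norm (x (k + 1) - x k))\<^sup>2
    + 2 * real CARD('m) * (\<xi> k + L22)\<^sup>2 * (norm (y (k + 1) - y k))\<^sup>2"
proof -
  let ?s = "norm (x (k + 1) - x k)" and ?e = "norm (y (k + 1) - y k)"
  have "(norm (fst (G k)))\<^sup>2 \<le> (1 / \<rho> * ?s + b k * \<delta>)\<^sup>2"
    by (intro power_mono gap_x k) auto
  \<comment> \<open>The weight 3/2 on the bias is below 2 on purpose: once the squared bias is at
    most \<epsilon>^2 / 2, a quarter of \<epsilon>^2 is left for the steps.\<close>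
  also have "(u + v)\<^sup>2 \<le> 3 * u\<^sup>2 + 3 / 2 * v\<^sup>2" for u v :: real
    using zero_le_power2[of "2 * u - v"] by (simp add: power2_eq_square algebra_simps)
  finally have fst: "(norm (fst (G k)))\<^sup>2 \<le> 3 / \<rho>\<^sup>2 * ?s\<^sup>2 + 3 / 2 * ((b k)\<^sup>2 * \<delta>\<^sup>2)"
    by (simp add: power_mult_distrib power_divide)
  have "(norm (snd (G k)))\<^sup>2 = (\<Sum>j\<in>UNIV. (norm (snd (G k) $ j))\<^sup>2)"
    by (rule power2_norm_vec)
  also have "\<dots> \<le> (\<Sum>j\<in>(UNIV :: 'm set). ((\<xi> k + L22) * ?e + L12 * ?s)\<^sup>2)"
    by (intro sum_mono power_mono gap_y k) auto
  also have "\<dots> = real CARD('m) * ((\<xi> k + L22) * ?e + L12 * ?s)\<^sup>2" by simp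
  also have "\<dots> \<le> real CARD('m) * (2 * ((\<xi> k + L22) * ?e)\<^sup>2 + 2 * (L12 * ?s)\<^sup>2)"
    using zero_le_power2[of "(\<xi> k + L22) * ?e - L12 * ?s"]
    by (intro mult_left_mono) (simp_all add: power2_diff power2_sum)
  finally have "(norm (snd (G k)))\<^sup>2 \<le> 2 * real CARD('m) * (\<xi> k + L22)\<^sup>2 * ?e\<^sup>2 + 2 * real CARD('m) * L12\<^sup>2 * ?s\<^sup>2"
    by (simp add: power_mult_distrib distrib_left mult_ac)
  moreover have "(norm (G k))\<^sup>2 = (norm (fst (G k)))\<^sup>2 + (norm (snd (G k)))\<^sup>2"
    by (simp add: norm_prod_def)
  ultimately show ?thesis
    using fst by (simp add: distrib_right)
qed

section \<open>Comparison of the gap coefficients with the energy weights\<close>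

lemma p_eq: "p k = 3200 * \<rho> * (\<tau> - 2) * L21\<^sup>2 / 19\<^sup>2 * sqrt (real k + 1)"
proof -
  have "sqrt (real k + 1) > 0" by simp
  then show ?thesis
    unfolding p_def b_square using \<rho> by (simp add: field_simps power2_eq_square)
qed

text \<open>Both \<xi> k + L22 = a + 16 \<tau> t and p k = 8 (\<tau> - 2) t are affine in the same
  \<open>t\<close>. The square is split by (u + v)^2 \<le> 2 u^2 + 2 v^2; since t^2 is proportional
  to k + 1, the constant part is absorbed through 1 \<le> k + 1.\<close>

lemma dual_coefficient:
  assumes k: "k \<ge> 1"
  shows "2 * real CARD('m) * (\<xi> k + L22)\<^sup>2 \<le> (16 * real CARD('m) * \<tau>\<^sup>2 / (\<tau> - 2)\<^sup>2
    + 19 ^ 4 * real CARD('m) * (\<rho> * L21\<^sup>2 - \<iota> + L22)\<^sup>2 / (16 * 20 ^ 4 * \<rho>\<^sup>2 * (\<tau> - 2)\<^sup>2 * L21 ^ 4)) * (p k)\<^sup>2"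
proof -
  define a t where "a = \<rho> * L21\<^sup>2 - \<iota> + L22" and "t = L21\<^sup>2 / (\<rho> * (b (k + 1))\<^sup>2)"
  have \<xi>: "\<xi> k + L22 = a + 16 * \<tau> * t" by (simp add: \<xi>_def a_def t_def)
  define \<sigma> where "\<sigma> = \<tau> - 2"
  have \<sigma>: "\<sigma> \<noteq> 0" using \<tau> by (simp add: \<sigma>_def)
  have p: "p k = 8 * \<sigma> * t" by (simp add: p_def t_def \<sigma>_def)
  have t: "t = 20\<^sup>2 * \<rho> * L21\<^sup>2 * sqrt (real k + 1) / 19\<^sup>2"
    unfolding t_def b_square using \<rho> by (simp add: field_simps power2_eq_square)
  have t2: "t\<^sup>2 = 20 ^ 4 * \<rho>\<^sup>2 * L21 ^ 4 * (real k + 1) / 19 ^ 4"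
    unfolding t by (simp add: power_mult_distrib power_divide)
  have "(a + 16 * \<tau> * t)\<^sup>2 \<le> 2 * a\<^sup>2 + 2 * (16 * \<tau> * t)\<^sup>2"
    using zero_le_power2[of "a - 16 * \<tau> * t"] by (simp add: power2_diff power2_sum)
  also have "\<dots> \<le> 2 * a\<^sup>2 * (real k + 1) + 512 * \<tau>\<^sup>2 * t\<^sup>2"
    by (simp add: power_mult_distrib mult_le_cancel_left1)
  finally have "2 * real CARD('m) * (\<xi> k + L22)\<^sup>2 \<le> 2 * real CARD('m) * (2 * a\<^sup>2 * (real k + 1) + 512 * \<tau>\<^sup>2 * t\<^sup>2)"
    unfolding \<xi> by (intro mult_left_mono) auto
  moreover have "16 * real CARD('m) * \<tau>\<^sup>2 / \<sigma>\<^sup>2 * (p k)\<^sup>2 = 2 * real CARD('m) * (512 * \<tau>\<^sup>2 * t\<^sup>2)"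
    unfolding p using \<sigma> by (simp add: power_mult_distrib)
  moreover have "19 ^ 4 * real CARD('m) * a\<^sup>2 / (16 * 20 ^ 4 * \<rho>\<^sup>2 * \<sigma>\<^sup>2 * L21 ^ 4) * (p k)\<^sup>2 = 2 * real CARD('m) * (2 * a\<^sup>2 * (real k + 1))"
    unfolding p power_mult_distrib t2 using \<sigma> \<rho> L_pos by simp
  ultimately show ?thesis
    unfolding a_def[symmetric] \<sigma>_def[symmetric] by (simp add: distrib_right distrib_left)
qed

text \<open>As \<open>p\<close> increases, index 2 is the worst case. There the two terms hold with
  the spare factors 10/9 and 10/3.\<close>

lemma primal_coefficient:
  assumes k: "k \<ge> 2" and r3: "r3 \<ge> (10 + 20 * real CARD('m) * \<rho>\<^sup>2 * L12\<^sup>2) / (9 * \<rho> * p 2)"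
  shows "3 / \<rho>\<^sup>2 + 2 * real CARD('m) * L12\<^sup>2 \<le> r3 * p k * (3 / \<rho>)"
proof -
  have p2: "p 2 > 0" by (rule p_pos) simp
  have p: "p 2 \<le> p k"
    unfolding p_eq using k \<tau> \<rho> by (intro mult_left_mono) auto
  have "0 \<le> (10 + 20 * real CARD('m) * \<rho>\<^sup>2 * L12\<^sup>2) / (9 * \<rho> * p 2)"
    using \<rho> p2 by simp
  with r3 have "r3 \<ge> 0" by linarith
  have "3 / \<rho>\<^sup>2 + 2 * real CARD('m) * L12\<^sup>2 \<le> (10 + 20 * real CARD('m) * \<rho>\<^sup>2 * L12\<^sup>2) / (9 * \<rho>) * (3 / \<rho>)"
  proof -
    have "(10 + 20 * real CARD('m) * \<rho>\<^sup>2 * L12\<^sup>2) / (9 * \<rho>) * (3 / \<rho>)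
        = (10 / 3) / \<rho>\<^sup>2 + 20 / 3 * real CARD('m) * L12\<^sup>2"
      using \<rho> by (simp add: field_simps power2_eq_square)
    moreover have "3 / \<rho>\<^sup>2 \<le> (10 / 3) / \<rho>\<^sup>2"
      by (intro divide_right_mono) auto
    moreover have "2 * real CARD('m) * L12\<^sup>2 \<le> 20 / 3 * real CARD('m) * L12\<^sup>2"
      by (intro mult_right_mono) auto
    ultimately show ?thesis by linarith
  qed
  also have "\<dots> = (10 + 20 * real CARD('m) * \<rho>\<^sup>2 * L12\<^sup>2) / (9 * \<rho> * p 2) * p 2 * (3 / \<rho>)"
    using p2 by simp
  also have "\<dots> \<le> r3 * p k * (3 / \<rho>)"
    using r3 p p2 \<rho> \<open>r3 \<ge> 0\<close> by (intro mult_right_mono mult_mono) auto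
  finally show ?thesis .
qed

text \<open>The bias term \<open>b k * \<delta>\<close> of the gap is small only for late \<open>k\<close>, so the energy estimate is used on
  the indices between \<open>R / 4\<close> and \<open>R\<close> alone.\<close>

lemma stationary_iterate_exists:
  fixes r2 r3 \<epsilon> :: real
  defines "R \<equiv> max ((2 * 80\<^sup>2 * \<rho> * (\<tau> - 2) * L21\<^sup>2 * r2 * r3 / (19\<^sup>2 * \<epsilon>\<^sup>2) + 2)\<^sup>2)
      (19 ^ 4 * \<delta> ^ 4 / (10 ^ 4 * \<rho> ^ 4 * \<epsilon> ^ 4))"
  assumes \<epsilon>: "\<epsilon> > 0"
    and r2: "r2 \<ge> l_max - l (x 2) (y 2) + 16 * \<delta>\<^sup>2 / (\<rho>\<^sup>2 * b 2) + A 2 * (norm (y 2 - y 1))\<^sup>2 + 8 * \<delta>\<^sup>2 / \<rho> + c 2 * \<delta>\<^sup>2"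
    and dual: "\<And>k. k \<ge> 2 \<Longrightarrow> 2 * real CARD('m) * (\<xi> k + L22)\<^sup>2 \<le> r3 * (p k)\<^sup>2"
    and primal: "\<And>k. k \<ge> 2 \<Longrightarrow> 3 / \<rho>\<^sup>2 + 2 * real CARD('m) * L12\<^sup>2 \<le> r3 * p k * (3 / \<rho>)"
  shows "\<exists>k\<ge>1. real k \<le> R \<and> norm (G k) \<le> \<epsilon>"
proof (rule ccontr)
  assume contra: "\<not> ?thesis"
  define \<kappa> where "\<kappa> = 3200 * \<rho> * (\<tau> - 2) * L21\<^sup>2 / 19\<^sup>2"
  define W where "W k = p k * (norm (y (k + 1) - y k))\<^sup>2 + 3 / \<rho> * (norm (x (k + 1) - x k))\<^sup>2" for k
  define N m where "N = nat \<lfloor>R\<rfloor>" and "m = max 2 (nat \<lceil>R / 4\<rceil>)"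
  have \<kappa>: "\<kappa> > 0" using \<rho> \<tau> L_pos by (simp add: \<kappa>_def)
  have W_nonneg: "W k \<ge> 0" if "k \<ge> 1" for k
    using p_pos[OF that] \<rho> by (simp add: W_def)
  have "0 \<le> 2 * real CARD('m) * (\<xi> 2 + L22)\<^sup>2" by simp
  also have "\<dots> \<le> r3 * (p 2)\<^sup>2" by (rule dual) simp
  finally have r3: "r3 \<ge> 0"
    using p_pos[of 2] by (simp add: zero_le_mult_iff)
  \<comment> \<open>At N = 1 the sum in \<open>energy\<close> is empty, so its right-hand side is
    nonnegative.\<close>
  have "r2 \<ge> 0" using energy[of 1] r2 by simp
  define q where "q = 4 * \<kappa> * r2 * r3 / \<epsilon>\<^sup>2"
  have q: "q \<ge> 0" using \<kappa> \<open>r2 \<ge> 0\<close> r3 by (simp add: q_def)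
  have q_eq: "2 * 80\<^sup>2 * \<rho> * (\<tau> - 2) * L21\<^sup>2 * r2 * r3 / (19\<^sup>2 * \<epsilon>\<^sup>2) = q"
    by (simp add: q_def \<kappa>_def)
  have R1: "(q + 2)\<^sup>2 \<le> R" and R2: "19 ^ 4 * \<delta> ^ 4 / (10 ^ 4 * \<rho> ^ 4 * \<epsilon> ^ 4) \<le> R"
    unfolding R_def q_eq by simp_all
  have "2\<^sup>2 \<le> (q + 2)\<^sup>2" using q by (intro power_mono) auto
  then have R4: "R \<ge> 4" using R1 by simp
  have sqrtR: "sqrt R \<ge> q + 2" using R1 by (rule real_le_rsqrt)
  note sums = sum_inverse_sqrt_quarter_ge[OF R4, folded N_def m_def]
  have R2': "19\<^sup>2 * \<delta>\<^sup>2 / (10\<^sup>2 * \<rho>\<^sup>2 * \<epsilon>\<^sup>2) \<le> sqrt R"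
  proof (rule real_le_rsqrt)
    have "(19\<^sup>2 * \<delta>\<^sup>2 / (10\<^sup>2 * \<rho>\<^sup>2 * \<epsilon>\<^sup>2))\<^sup>2 = 19 ^ 4 * \<delta> ^ 4 / (10 ^ 4 * \<rho> ^ 4 * \<epsilon> ^ 4)"
      by (simp add: power_divide power_mult_distrib)
    then show "(19\<^sup>2 * \<delta>\<^sup>2 / (10\<^sup>2 * \<rho>\<^sup>2 * \<epsilon>\<^sup>2))\<^sup>2 \<le> R" using R2 by simp
  qed
  have late: "\<epsilon>\<^sup>2 / (4 * \<kappa>) * (1 / sqrt (real k + 1)) < r3 * W k" if k: "k \<in> {m..N}" for k
  proof -
    have k2: "k \<ge> 2" and kR: "real k \<ge> R / 4" "real k \<le> R"
      using k R4 by (auto simp: m_def N_def le_nat_floor) linarith+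
    let ?s = "(norm (x (k + 1) - x k))\<^sup>2" and ?e = "(norm (y (k + 1) - y k))\<^sup>2"
    have "\<epsilon> < norm (G k)" using contra k2 kR by force
    then have "\<epsilon>\<^sup>2 < (norm (G k))\<^sup>2" using \<epsilon> by (intro power_strict_mono) auto
    \<comment> \<open>The second entry of the maximum is used here: from k \<ge> R / 4 one has sqrt
      k \<ge> sqrt R / 2, and (b k)^2 is proportional to 1 / sqrt k.\<close>
    moreover have "(b k)\<^sup>2 * \<delta>\<^sup>2 \<le> \<epsilon>\<^sup>2 / 2"
    proof -
      have "sqrt (R / 4) \<le> sqrt k" using kR by simp
      then have "sqrt R \<le> 2 * sqrt k" by (simp add: real_sqrt_divide)
      then have "19\<^sup>2 * \<delta>\<^sup>2 / (10\<^sup>2 * \<rho>\<^sup>2 * \<epsilon>\<^sup>2) \<le> 2 * sqrt k" using R2' by linarith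
      then have "19\<^sup>2 * \<delta>\<^sup>2 \<le> 2 * sqrt k * (10\<^sup>2 * \<rho>\<^sup>2 * \<epsilon>\<^sup>2)"
        using \<rho> \<epsilon> by (subst (asm) pos_divide_le_eq) auto
      then show ?thesis
        unfolding b_square using \<rho> k2 by (simp add: field_simps)
    qed
    moreover have "(3 / \<rho>\<^sup>2 + 2 * real CARD('m) * L12\<^sup>2) * ?s \<le> r3 * p k * (3 / \<rho>) * ?s"
      by (intro mult_right_mono primal k2) auto
    moreover have "2 * real CARD('m) * (\<xi> k + L22)\<^sup>2 * ?e \<le> r3 * (p k)\<^sup>2 * ?e"
      by (intro mult_right_mono dual k2) auto
    ultimately have "\<epsilon>\<^sup>2 / 4 < r3 * p k * (3 / \<rho>) * ?s + r3 * (p k)\<^sup>2 * ?e"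
      using gap_square[of k] k2 by simp
    also have "\<dots> = r3 * W k * p k"
      by (simp add: W_def distrib_left distrib_right power2_eq_square mult_ac)
    finally have "\<epsilon>\<^sup>2 / 4 / p k < r3 * W k"
      using p_pos[of k] k2 by (simp add: pos_divide_less_eq)
    then show ?thesis unfolding p_eq \<kappa>_def[symmetric] by (simp add: mult.assoc)
  qed
  \<comment> \<open>\<open>q\<close> is at most sqrt R - 2, the lower bound for the sum over {m..N}.
    As this index set is nonempty, \<open>late\<close> sums to a strict inequality, and the chain
    ends in r2 * r3 < r3 * r2.\<close>
  have "r2 * r3 = \<epsilon>\<^sup>2 / (4 * \<kappa>) * q"
    using \<kappa> \<epsilon> by (simp add: q_def)
  also have "\<dots> \<le> \<epsilon>\<^sup>2 / (4 * \<kappa>) * (\<Sum>k=m..N. 1 / sqrt (real k + 1))"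
    using sums(2) sqrtR \<kappa> by (intro mult_left_mono) auto
  also have "\<dots> = (\<Sum>k=m..N. \<epsilon>\<^sup>2 / (4 * \<kappa>) * (1 / sqrt (real k + 1)))"
    by (rule sum_distrib_left)
  also have "\<dots> < (\<Sum>k=m..N. r3 * W k)"
    using sums(1) by (intro sum_strict_mono late) auto
  also have "\<dots> = r3 * (\<Sum>k=m..N. W k)"
    by (rule sum_distrib_left[symmetric])
  also have "\<dots> \<le> r3 * (\<Sum>k=2..N. W k)"
    using r3 by (intro mult_left_mono sum_mono2 W_nonneg) (auto simp: m_def)
  also have "\<dots> \<le> r3 * r2"
    using energy[of N] sums(1) r2 r3 by (intro mult_left_mono) (auto simp: W_def m_def)
  finally show False by simp
qed

end

theorem theorem5p4:
  fixes f :: "(real ^ 'dx, 'k1::{finite,linorder}) vec \<times> (real ^ 'dy, 'k2::{finite,linorder}) vec \<Rightarrow> real"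
    and h :: "'k1 \<Rightarrow> real ^ 'dx \<Rightarrow> real" and g :: "'k2 \<Rightarrow> real ^ 'dy \<Rightarrow> real"
    and X :: "'k1 \<Rightarrow> (real ^ 'dx) set" and Y :: "'k2 \<Rightarrow> (real ^ 'dy) set"
    and x :: "nat \<Rightarrow> (real ^ 'dx, 'k1) vec" and y :: "nat \<Rightarrow> (real ^ 'dy, 'k2) vec"
    and L11 L12 L21 L22 \<rho> \<iota> \<tau> \<epsilon> :: real
    and K2 \<delta> l_max r2 r3 d1 \<L>0 \<L>2 :: real
    and G :: "nat \<Rightarrow> (real ^ 'dx, 'k1) vec \<times> (real ^ 'dy, 'k2) vec"
    and b \<theta> p :: "nat \<Rightarrow> real"
  assumes K1: "CARD('k1) = 1"
    and X: "\<And>i. X i \<noteq> {} \<and> compact (X i) \<and> convex (X i)"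
    and Y: "\<And>j. Y j \<noteq> {} \<and> compact (Y j) \<and> convex (Y j)"
    and f: "continuously_differentiable f"
    and h: "\<And>i. convex_on UNIV (h i) \<and> continuous_on UNIV (h i)"
    and g: "\<And>j. convex_on UNIV (g j) \<and> continuous_on UNIV (g j)"
    and f_convex: "\<And>v. v \<in> block_prod Y \<Longrightarrow> convex_on (block_prod X) (\<lambda>u. f (u, v))"
    and L_pos: "L11 > 0" "L12 > 0" "L21 > 0" "L22 > 0"
    and f_lipschitz: "lipschitz_gradient f (block_prod X) (block_prod Y) L11 L12 L21 L22"
    and \<rho>: "\<rho> > 0" "\<rho> \<le> 1 / (10 * L11)"
    and \<iota>: "\<iota> > 0"
  defines "K2 \<equiv> real CARD('k2)"
    and "b \<equiv> \<lambda>k. 19 / (20 * \<rho> * real k powr (1 / 4))"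
  assumes \<tau>: "\<tau> > max (\<rho> * (b 2)\<^sup>2 * (L22 + 2 * \<iota> - \<rho> * L21\<^sup>2) / (16 * L21\<^sup>2)) 2"
  defines "\<theta> \<equiv> \<lambda>k. \<rho> * L21\<^sup>2 + 16 * \<tau> * L21\<^sup>2 / (\<rho> * (b (k + 1))\<^sup>2) - 2 * \<iota>"
    and "p \<equiv> \<lambda>k. 8 * (\<tau> - 2) * L21\<^sup>2 / (\<rho> * (b (k + 1))\<^sup>2)"
  assumes xy: "bapg f h g X Y (\<lambda>k i. 1 / \<rho>) (\<lambda>k j. \<iota> + \<theta> k) b (\<lambda>k. 0) x y"
    and \<epsilon>: "\<epsilon> > 0"
  defines "\<delta> \<equiv> SUP u\<in>block_prod X. norm u"
    and "l_max \<equiv> SUP (u, v)\<in>block_prod X \<times> block_prod Y. objective f h g u v"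
    and "\<L>0 \<equiv> l_max + (2 powr (13 / 4) + 15 + 19 / 40) * (\<delta>\<^sup>2 / \<rho>)"
    and "\<L>2 \<equiv> objective f h g (x 2) (y 2) - 16 * \<delta>\<^sup>2 / (\<rho>\<^sup>2 * b 2) - 8 * \<delta>\<^sup>2 / \<rho>
           - (\<rho> * L21\<^sup>2 / 2 + 16 * L21\<^sup>2 / (\<rho> * (b 2)\<^sup>2)) * (norm (y 2 - y 1))\<^sup>2"
    and "d1 \<equiv> 16 * K2 * \<tau>\<^sup>2 / (\<tau> - 2)\<^sup>2
           + 19 ^ 4 * K2 * (\<rho> * L21\<^sup>2 - \<iota> + L22)\<^sup>2 / (16 * 20 ^ 4 * \<rho>\<^sup>2 * (\<tau> - 2)\<^sup>2 * L21 ^ 4)"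
    and "r2 \<equiv> \<L>0 - \<L>2 + 8 * 2 powr (1 / 4) / \<rho> * \<delta>\<^sup>2 + 19 / (40 * \<rho>) * \<delta>\<^sup>2"
    and "r3 \<equiv> max d1 ((10 + 20 * K2 * \<rho>\<^sup>2 * L12\<^sup>2) / (9 * \<rho> * p 2))"
    and "G \<equiv> \<lambda>k. stationarity_gap f h g X Y (\<lambda>i. 1 / \<rho>) (\<lambda>j. \<iota> + \<theta> k) (x k) (y k)"
  shows "(\<exists>k\<ge>1. norm (G k) \<le> \<epsilon>) \<and>
    real (hitting_time G \<epsilon>)
      \<le> max ((2 * 80\<^sup>2 * \<rho> * (\<tau> - 2) * L21\<^sup>2 * r2 * r3 / (19\<^sup>2 * \<epsilon>\<^sup>2) + 2)\<^sup>2)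
            (19 ^ 4 * \<delta> ^ 4 / (10 ^ 4 * \<rho> ^ 4 * \<epsilon> ^ 4))"
proof -
  define \<xi> where "\<xi> k = \<iota> + \<theta> k" for k
  have \<xi>: "\<xi> = (\<lambda>k. \<rho> * L21\<^sup>2 + 16 * \<tau> * L21\<^sup>2 / (\<rho> * (b (k + 1))\<^sup>2) - \<iota>)"
    by (simp add: \<xi>_def \<theta>_def fun_eq_iff)
  interpret bapg: convex_nonconcave_bapg f h g X Y x y L11 L12 L21 L22 \<rho> \<iota> \<tau> b \<xi> p
  proof
    show "b = (\<lambda>k. 19 / (20 * \<rho> * real k powr (1/4)))" by (simp add: b_def)
    show "p = (\<lambda>k. 8 * (\<tau> - 2) * L21\<^sup>2 / (\<rho> * (b (k + 1))\<^sup>2))" by (simp add: p_def)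
    show "bapg f h g X Y (\<lambda>k i. 1 / \<rho>) (\<lambda>k j. \<xi> k) b (\<lambda>k. 0) x y" using xy by (simp add: \<xi>_def)
    show "\<tau> > 2" "\<tau> > \<rho> * (b 2)\<^sup>2 * (L22 + 2 * \<iota> - \<rho> * L21\<^sup>2) / (16 * L21\<^sup>2)" using \<tau> by simp_all
  qed (fact \<xi> | use K1 X Y f h g f_convex L_pos f_lipschitz \<rho> \<iota> in blast)+
  have G: "G = (\<lambda>k. stationarity_gap f h g X Y (\<lambda>i. 1 / \<rho>) (\<lambda>j. \<xi> k) (x k) (y k))"
    by (simp add: G_def \<xi>_def)
  define R where "R = max ((2 * 80\<^sup>2 * \<rho> * (\<tau> - 2) * L21\<^sup>2 * r2 * r3 / (19\<^sup>2 * \<epsilon>\<^sup>2) + 2)\<^sup>2)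
      (19 ^ 4 * \<delta> ^ 4 / (10 ^ 4 * \<rho> ^ 4 * \<epsilon> ^ 4))"
  have "\<exists>k\<ge>1. real k \<le> R \<and> norm (G k) \<le> \<epsilon>"
    unfolding R_def \<delta>_def G
  proof (rule bapg.stationary_iterate_exists[OF \<epsilon>], unfold \<delta>_def[symmetric] l_max_def[symmetric] K2_def[symmetric])
    \<comment> \<open>This is \<open>c 2\<close>, evaluated with b 1 / b 2 = 2 powr (1/4), in order
      to compare the energy bound with \<open>r2\<close> term by term.\<close>
    have "b 1 / 2 + 4 / \<rho> * (b 1 / b 2 - 1) = 19 / (40 * \<rho>) + 4 * 2 powr (1/4) / \<rho> - 4 / \<rho>"
      using \<rho> by (simp add: b_def field_simps)
    then have "(b 1 / 2 + 4 / \<rho> * (b 1 / b 2 - 1)) * \<delta>\<^sup>2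
        = 19 / (40 * \<rho>) * \<delta>\<^sup>2 + 4 * 2 powr (1/4) / \<rho> * \<delta>\<^sup>2 - 4 / \<rho> * \<delta>\<^sup>2"
      by (simp add: distrib_right left_diff_distrib)
    moreover have "4 * 2 powr (1/4) / \<rho> * \<delta>\<^sup>2 \<le> 8 * 2 powr (1/4) / \<rho> * \<delta>\<^sup>2"
      using \<rho> by (intro mult_right_mono divide_right_mono) auto
    moreover have "0 \<le> (2 powr (13/4) + 15 + 19/40) * (\<delta>\<^sup>2 / \<rho>)" "0 \<le> 4 / \<rho> * \<delta>\<^sup>2"
      using \<rho> by (auto intro!: mult_nonneg_nonneg add_nonneg_nonneg)
    ultimately show "l_max - objective f h g (x 2) (y 2) + 16 * \<delta>\<^sup>2 / (\<rho>\<^sup>2 * b 2)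
        + (\<rho> * L21\<^sup>2 / 2 + 16 * L21\<^sup>2 / (\<rho> * (b 2)\<^sup>2)) * (norm (y 2 - y 1))\<^sup>2 + 8 * \<delta>\<^sup>2 / \<rho>
        + (b (2 - 1) / 2 + 4 / \<rho> * (b (2 - 1) / b 2 - 1)) * \<delta>\<^sup>2 \<le> r2"
      unfolding r2_def \<L>0_def \<L>2_def by simp
  next
    fix k :: nat assume k: "k \<ge> 2"
    have "2 * K2 * (\<xi> k + L22)\<^sup>2 \<le> d1 * (p k)\<^sup>2"
      using bapg.dual_coefficient[of k] k unfolding d1_def K2_def by simp
    also have "\<dots> \<le> r3 * (p k)\<^sup>2"
      by (intro mult_right_mono) (simp_all add: r3_def)
    finally show "2 * K2 * (\<xi> k + L22)\<^sup>2 \<le> r3 * (p k)\<^sup>2" .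
    show "3 / \<rho>\<^sup>2 + 2 * K2 * L12\<^sup>2 \<le> r3 * p k * (3 / \<rho>)"
      using bapg.primal_coefficient[OF k, of r3] unfolding K2_def[symmetric] by (simp add: r3_def)
  qed
  then obtain k where k: "k \<ge> 1" "real k \<le> R" "norm (G k) \<le> \<epsilon>" by blast
  then have "hitting_time G \<epsilon> \<le> k"
    unfolding hitting_time_def by (intro Least_le) simp
  then have "real (hitting_time G \<epsilon>) \<le> R" using k by linarith
  then show ?thesis using k unfolding R_def by blast
qed

end
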